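(* Let $g\ge1$, let $a_1,\dots,a_{2g+1}\in\mathbb C$ satisfy $|a_1|<|a_2|<\dots<|a_{2g+1}|<1$, and let $P(z)=\prod_{j=1}^{2g+1}(z-a_j)$. Let $\mathcal W(z)=\mathrm{diag}(w_1(z),w_2(z))$ with $$w_1(z)=1,\qquad w_2(z)=\Big(\frac{P(z)}{z}\Big)^{1/2}\frac{1}{\prod_{j=1}^{g}(z-a_j)},$$ and let $T_-,T_+$ solve the factorization problem $$\exp\big(\xi(\tilde t,\Lambda)\big)\mathcal W(z)=T_-(\tilde t;z)T_+(\tilde t;z),\qquad T_-(\tilde t;\infty)=I.$$ Put $A=\begin{pmatrix}1&\sqrt z\\1&-\sqrt z\end{pmatrix}$ and $$S(\tilde t;z):=\begin{cases}A\exp\big(-\xi(\tilde t,\Lambda)\big)T_-(\tilde t;z),&|z|\ge1,\\[2pt] A\,\mathcal W(z)\,T_+^{-1}(\tilde t;z),&|z|\le 1.\end{cases}$$ Then $S(\tilde t;z)$ has the following properties: (1) It has no jump on $S^1$. (2) It has jumps on the cuts $l_1,\dots,l_{g+1}$: denoting by $S_L$ and $S_R$ the limiting values of $S$ from the left and from the right of a cut, $$S_L(\tilde t;z)=\begin{pmatrix}0&1\\1&0\end{pmatrix}S_R(\tilde t;z).$$ (3) It is invertible at every (finite) point except the points $a_j$; near $a_j$ it has the form $$S(\tilde t;z)=\begin{pmatrix}1&1\\1&-1\end{pmatrix}\begin{pmatrix}1&0\\0&(z-a_j)^{\pm1/2}\end{pmatrix}S_j(\tilde t;z)$$ with $S_j(\tilde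 t;z)$ invertible at $a_j$, the sign being minus for $a_1,\dots,a_g$ and plus for the others. (4) At infinity it behaves as $$S(\tilde t;z)\sim\begin{pmatrix}\exp\big(-\sqrt z\,(t_1+t_3z+\dots)\big)&\sqrt z\exp\big(-\sqrt z\,(t_1+t_3z+\dots)\big)\\ \exp\big(\sqrt z\,(t_1+t_3z+\dots)\big)&-\sqrt z\exp\big(\sqrt z\,(t_1+t_3z+\dots)\big)\end{pmatrix}.$$
   Context: Here $n=2$; $\tilde t=(t_1,t_3,t_5,\dots)$ with finitely many nonzero entries, $\Lambda=\begin{pmatrix}0&z\\1&0\end{pmatrix}$ and $\xi(\tilde t,\Lambda)=\sum_{i\text{ odd}}t_i\Lambda^i$. $T_-$ and $T_+$ are analytic and invertible outside and inside the unit circle $S^1$ respectively (with boundary values on $S^1$); $\tilde t$ is such that this factorization exists. The cuts $l_1,\dots,l_{g+1}$ are the oriented intervals $(a_1,a_2),(a_3,a_4),\dots,(a_{2g-1},a_{2g}),(a_{2g+1},\infty)$ (pairwise disjoint arcs, the first $g$ lying inside the unit disc). The branch of $P(z)^{1/2}$ is cut along the $l_j$; $(P(z)/z)^{1/2}=z^g(1+O(z^{-1}))$ is analytic for $|z|\ge1$, and for $|z|\ge1$ the root $\sqrt z$ is cut along the part of $l_{g+1}$ lying there, so that $P(z)^{1/2}=\sqrt z\,(P(z)/z)^{1/2}$; for $|z|\le1$, $A\mathcal W(z)=\begin{pmatrix}1&P(z)^{1/2}/\prod_{j=1}^g(z-a_j)\\1&-P(z)^{1/2}/\prod_{j=1}^g(z-a_j)\end{pmatrix}$.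 "No jump on $S^1$" means that the limiting values from inside and outside coincide on $S^1$ (off the cut). "$S\sim M$ at infinity" means $S=M\,(I+O(z^{-1}))$. *)

theory Defs
  imports "HOL-Analysis.Analysis" "HOL-Library.Landau_Symbols"
begin

type_synonym cmat2 = "complex^2^2"

definition mat2 :: "complex \<Rightarrow> complex \<Rightarrow> complex \<Rightarrow> complex \<Rightarrow> cmat2" where
  "mat2 a b c d = vector [vector [a, b], vector [c, d]]"

text \<open>The multiplication of the type \<^typ>\<open>cmat2\<close> inherited from the class \<^class>\<open>times\<close> is
  componentwise, so \<open>^\<close> and \<open>exp\<close> do not give the matrix power and the matrix exponential.\<close>

definition mpow :: "cmat2 \<Rightarrow> nat \<Rightarrow> cmat2" where
  "mpow M n = (((**) M) ^^ n) (mat 1)"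

definition mexp :: "cmat2 \<Rightarrow> cmat2" where
  "mexp M = (\<Sum>n. (1 / fact n) *\<^sub>R mpow M n)"

definition mat_analytic_on :: "(complex \<Rightarrow> cmat2) \<Rightarrow> complex set \<Rightarrow> bool" where
  "mat_analytic_on F D \<longleftrightarrow> (\<forall>i j. (\<lambda>z. F z $ i $ j) analytic_on D)"

definition Lambda :: "complex \<Rightarrow> cmat2" where
  "Lambda z = mat2 0 z 1 0"

text \<open>The times are \<open>t 1, t 3, t 5, \<dots>\<close>; the values of \<open>t\<close> at even arguments play no role.\<close>

definition times_support :: "(nat \<Rightarrow> complex) \<Rightarrow> nat set" where
  "times_support t = {i. odd i \<and> t i \<noteq> 0}"

definition xi :: "(nat \<Rightarrow> complex) \<Rightarrow> complex \<Rightarrow> cmat2" where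
  "xi t z = (\<Sum>i\<in>times_support t. mat (t i) ** mpow (Lambda z) i)"

definition Ppoly :: "nat \<Rightarrow> (nat \<Rightarrow> complex) \<Rightarrow> complex \<Rightarrow> complex" where
  "Ppoly g a z = (\<Prod>j = 1..2 * g + 1. z - a j)"

definition Qpoly :: "nat \<Rightarrow> (nat \<Rightarrow> complex) \<Rightarrow> complex \<Rightarrow> complex" where
  "Qpoly g a z = (\<Prod>j = 1..g. z - a j)"

definition sqrt_branch :: "complex set \<Rightarrow> (complex \<Rightarrow> complex) \<Rightarrow> (complex \<Rightarrow> complex) \<Rightarrow> bool" where
  "sqrt_branch D f r \<longleftrightarrow> r analytic_on D \<and> (\<forall>z\<in>D. (r z)\<^sup>2 = f z)"

text \<open>For \<open>j \<le> g\<close> the cut \<open>\<gamma> j\<close> is parametrised by \<open>[0,1]\<close>; the last one, which runs to infinity, by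
  \<open>[0,1)\<close>. \<open>cut g \<gamma> j\<close> contains the finite endpoints; the oriented open arc \<open>l_j\<close> itself is the image of
  \<open>(0,1)\<close>. The open arcs are regular of class \<open>C\<^sup>1\<close>, so that they have a left and a right side.\<close>

definition cut :: "nat \<Rightarrow> (nat \<Rightarrow> real \<Rightarrow> complex) \<Rightarrow> nat \<Rightarrow> complex set" where
  "cut g \<gamma> j = \<gamma> j ` (if j \<le> g then {0..1} else {0..<1})"

definition cuts :: "nat \<Rightarrow> (nat \<Rightarrow> real \<Rightarrow> complex) \<Rightarrow> complex set" where
  "cuts g \<gamma> = (\<Union>j\<in>{1..g + 1}. cut g \<gamma> j)"

definition cut_system :: "nat \<Rightarrow> (nat \<Rightarrow> complex) \<Rightarrow> (nat \<Rightarrow> real \<Rightarrow> complex) \<Rightarrow> bool" where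
  "cut_system g a \<gamma> \<longleftrightarrow>
     (\<forall>j\<in>{1..g}. arc (\<gamma> j) \<and> pathstart (\<gamma> j) = a (2 * j - 1) \<and> pathfinish (\<gamma> j) = a (2 * j)
        \<and> path_image (\<gamma> j) \<subseteq> ball 0 1) \<and>
     continuous_on {0..<1} (\<gamma> (g + 1)) \<and> inj_on (\<gamma> (g + 1)) {0..<1} \<and>
     \<gamma> (g + 1) 0 = a (2 * g + 1) \<and> filterlim (\<gamma> (g + 1)) at_infinity (at_left 1) \<and>
     (\<forall>j\<in>{1..g + 1}. \<gamma> j C1_differentiable_on {0<..<1} \<and>
        (\<forall>s\<in>{0<..<1}. vector_derivative (\<gamma> j) (at s) \<noteq> 0)) \<and>
     disjoint_family_on (cut g \<gamma>) {1..g + 1}"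

text \<open>Points on the left of an oriented arc, close to \<open>c s0\<close>, are \<open>c s + r \<i> c'(s)\<close> with \<open>s\<close> close to \<open>s0\<close>
  and small \<open>r > 0\<close>; on the right, \<open>c s - r \<i> c'(s)\<close>. Since \<open>s\<close> varies together with \<open>r\<close>, these are
  unrestricted one-sided limits and not only limits along the normal at \<open>c s0\<close>.\<close>

definition has_left_limit :: "(complex \<Rightarrow> cmat2) \<Rightarrow> cmat2 \<Rightarrow> (real \<Rightarrow> complex) \<Rightarrow> real \<Rightarrow> bool" where
  "has_left_limit F M c s0 \<longleftrightarrow>
     ((\<lambda>(s, r). F (c s + of_real r * (\<i> * vector_derivative c (at s)))) \<longlongrightarrow> M)
       (nhds s0 \<times>\<^sub>F at_right 0)"

definition has_right_limit :: "(complex \<Rightarrow> cmat2) \<Rightarrow> cmat2 \<Rightarrow> (real \<Rightarrow> complex) \<Rightarrow> real \<Rightarrow> bool" where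
  "has_right_limit F M c s0 \<longleftrightarrow>
     ((\<lambda>(s, r). F (c s - of_real r * (\<i> * vector_derivative c (at s)))) \<longlongrightarrow> M)
       (nhds s0 \<times>\<^sub>F at_right 0)"

text \<open>Analyticity of \<open>Tm\<close> at infinity follows from the existence of its limit there.\<close>

definition factorization ::
  "(complex \<Rightarrow> cmat2) \<Rightarrow> (complex \<Rightarrow> cmat2) \<Rightarrow> (complex \<Rightarrow> cmat2) \<Rightarrow> bool" where
  "factorization G Tm Tp \<longleftrightarrow>
     mat_analytic_on Tm {z. 1 < cmod z} \<and> continuous_on {z. 1 \<le> cmod z} Tm \<and>
     (\<forall>z. 1 \<le> cmod z \<longrightarrow> invertible (Tm z)) \<and> (Tm \<longlongrightarrow> mat 1) at_infinity \<and>
     mat_analytic_on Tp {z. cmod z < 1} \<and> continuous_on {z. cmod z \<le> 1} Tp \<and>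
     (\<forall>z. cmod z \<le> 1 \<longrightarrow> invertible (Tp z)) \<and>
     (\<forall>z. cmod z = 1 \<longrightarrow> G z = Tm z ** Tp z)"

text \<open>Below, \<open>q\<close>, \<open>sq\<close> and \<open>R\<close> stand for the chosen branches, with \<open>P = Ppoly g a\<close>, of \<open>(P z / z)\<^bsup>1/2\<^esup>\<close>, \<open>z\<^bsup>1/2\<^esup>\<close> and
  \<open>(P z)\<^bsup>1/2\<^esup>\<close>.\<close>

definition Wmat :: "nat \<Rightarrow> (nat \<Rightarrow> complex) \<Rightarrow> (complex \<Rightarrow> complex) \<Rightarrow> complex \<Rightarrow> cmat2" where
  "Wmat g a q z = mat2 1 0 0 (q z * (1 / Qpoly g a z))"

definition Amat :: "(complex \<Rightarrow> complex) \<Rightarrow> complex \<Rightarrow> cmat2" where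
  "Amat sq z = mat2 1 (sq z) 1 (- sq z)"

definition AWmat :: "nat \<Rightarrow> (nat \<Rightarrow> complex) \<Rightarrow> (complex \<Rightarrow> complex) \<Rightarrow> complex \<Rightarrow> cmat2" where
  "AWmat g a R z = mat2 1 (R z / Qpoly g a z) 1 (- (R z / Qpoly g a z))"

definition S_out ::
  "(nat \<Rightarrow> complex) \<Rightarrow> (complex \<Rightarrow> complex) \<Rightarrow> (complex \<Rightarrow> cmat2) \<Rightarrow> complex \<Rightarrow> cmat2" where
  "S_out t sq Tm z = Amat sq z ** mexp (- xi t z) ** Tm z"

definition S_in ::
  "nat \<Rightarrow> (nat \<Rightarrow> complex) \<Rightarrow> (complex \<Rightarrow> complex) \<Rightarrow> (complex \<Rightarrow> cmat2) \<Rightarrow> complex \<Rightarrow> cmat2" where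
  "S_in g a R Tp z = AWmat g a R z ** matrix_inv (Tp z)"

text \<open>\<open>S_out\<close> and \<open>S_in\<close> overlap on the unit circle, where \<open>Sfun\<close> takes the value of \<open>S_out\<close>.\<close>

definition Sfun ::
  "nat \<Rightarrow> (nat \<Rightarrow> complex) \<Rightarrow> (nat \<Rightarrow> complex) \<Rightarrow> (complex \<Rightarrow> complex) \<Rightarrow> (complex \<Rightarrow> complex) \<Rightarrow>
   (complex \<Rightarrow> cmat2) \<Rightarrow> (complex \<Rightarrow> cmat2) \<Rightarrow> complex \<Rightarrow> cmat2" where
  "Sfun g a t sq R Tm Tp z = (if 1 \<le> cmod z then S_out t sq Tm z else S_in g a R Tp z)"

definition theta :: "(nat \<Rightarrow> complex) \<Rightarrow> (complex \<Rightarrow> complex) \<Rightarrow> complex \<Rightarrow> complex" where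
  "theta t sq z = sq z * (\<Sum>i\<in>times_support t. t i * z ^ ((i - 1) div 2))"

definition S_asymp :: "(nat \<Rightarrow> complex) \<Rightarrow> (complex \<Rightarrow> complex) \<Rightarrow> complex \<Rightarrow> cmat2" where
  "S_asymp t sq z =
     mat2 (exp (- theta t sq z)) (sq z * exp (- theta t sq z))
          (exp (theta t sq z)) (- sq z * exp (theta t sq z))"

end

theory Submission
  imports Defs "HOL-Complex_Analysis.Conformal_Mappings"
begin

text \<open>Off the cuts, \<open>S z = mat2 1 (R z) 1 (- R z) ** N z\<close>, where \<open>N\<close> is
  \<open>diag(1, 1/Q) T\<^sub>+\<^sup>-\<^sup>1\<close> in the disc and \<open>diag(1, 1/q) exp(- \<xi>) T\<^sub>-\<close> outside, with \<open>Q = (z - a\<^sub>1) \<cdots> (z - a\<^sub>g)\<close> and \<open>q\<close>, \<open>R\<close>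
  the branches of \<open>(P/z)\<^sup>1\<^sup>/\<^sup>2\<close> and \<open>P\<^sup>1\<^sup>/\<^sup>2\<close>. Multiplying the
  factorization \<open>exp \<xi> W = T\<^sub>- T\<^sub>+\<close> by \<open>exp(- \<xi>)\<close> from the left and by \<open>T\<^sub>+\<^sup>-\<^sup>1\<close> from the right
  shows that the two expressions for \<open>N\<close> agree on the unit circle. So \<open>N\<close>
  (\<open>regular_factor\<close> below) is continuous and invertible except at \<open>a\<^sub>1, \<dots>, a\<^sub>g\<close>, it has no branches at all,
  and all the multivaluedness of \<open>S\<close> sits in the scalar function \<open>R\<close>. The absence of a jump on the circle
  and the invertibility of \<open>S\<close> off the cuts follow at once.

  Exchanging the rows of \<open>mat2 1 w 1 (- w)\<close> is the same as replacing \<open>w\<close> by \<open>- w\<close>. The jump condition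
  therefore says exactly that \<open>R\<close> has one-sided limits on every cut and that these are opposite
  (\<open>sqrt_flips_across_slit\<close>). All that is used about \<open>R\<close> is that it is an analytic square root of \<open>P\<close> off
  the cuts, and the opposite signs have to be deduced from that. Close to an inner point of a cut, each of the
  two sides is a connected set on which \<open>R\<close> is \<open>\<plusminus> p\<close>, with \<open>p\<close> an analytic square root of \<open>P\<close> in a full
  disc. Hence \<open>R\<close> either changes sign there or continues analytically across the cut, and which of the two
  happens is locally constant along the cut, hence constant. If \<open>R\<close> continued across the whole cut,
  it would be analytic in a punctured disc around the first endpoint; the singularity would be
  removable, and \<open>P\<close>, as a square, would have a multiple zero there, whereas its zeros \<open>a\<^sub>j\<close> are simple.

  Near \<open>a\<^sub>j\<close>, write \<open>P = (z - a\<^sub>j) p\<^sup>2\<close> with \<open>p\<close> analytic and nonzero. Then \<open>R/p\<close> is a branch of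
  \<open>(z - a\<^sub>j)\<^sup>1\<^sup>/\<^sup>2\<close>, and it appears with exponent \<open>-1\<close> or \<open>1\<close> in \<open>R/Q\<close> according to whether \<open>Q\<close> contains the
  factor \<open>z - a\<^sub>j\<close> (\<open>R_over_Q_at_branch_point\<close>).

  At infinity the rows \<open>(1, \<plusminus> \<surd>z)\<close> of \<open>A\<close> are left eigenvectors of \<open>\<Lambda>\<close>, so that
  \<open>A exp(- \<xi>) = diag(exp(- \<theta>), exp \<theta>) A\<close>; this is the asserted leading term, and the remaining factor \<open>T\<^sub>-\<close>
  is \<open>I + O(1/z)\<close> because its singularity at infinity is removable.\<close>

section \<open>Two-by-two matrices\<close>

lemma mat2_nth [simp]:
  "mat2 a b c d $ 1 $ 1 = a" "mat2 a b c d $ 1 $ 2 = b"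
  "mat2 a b c d $ 2 $ 1 = c" "mat2 a b c d $ 2 $ 2 = d"
  by (simp_all add: mat2_def vector_2)

lemma cmat2_eq_iff:
  "(M :: cmat2) = N \<longleftrightarrow> M$1$1 = N$1$1 \<and> M$1$2 = N$1$2 \<and> M$2$1 = N$2$1 \<and> M$2$2 = N$2$2"
  by (auto simp: vec_eq_iff forall_2)

lemma cmat2_mult_nth:
  "((M :: cmat2) ** N) $ i $ j = M$i$1 * N$1$j + M$i$2 * N$2$j"
  by (simp add: matrix_matrix_mult_def sum_2)

lemma mat_nth [simp]:
  "(mat x :: cmat2) $ 1 $ 1 = x" "(mat x :: cmat2) $ 1 $ 2 = 0"
  "(mat x :: cmat2) $ 2 $ 1 = 0" "(mat x :: cmat2) $ 2 $ 2 = x"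
  by (simp_all add: mat_def)

lemma mat2_mult:
  "mat2 a b c d ** mat2 a' b' c' d' =
     mat2 (a * a' + b * c') (a * b' + b * d') (c * a' + d * c') (c * b' + d * d')"
  by (simp add: cmat2_eq_iff cmat2_mult_nth)

lemma tendsto_cmat2_iff:
  "((F :: _ \<Rightarrow> cmat2) \<longlongrightarrow> M) G \<longleftrightarrow> (\<forall>i j. ((\<lambda>x. F x $ i $ j) \<longlongrightarrow> M $ i $ j) G)"
proof
  show "(F \<longlongrightarrow> M) G \<Longrightarrow> \<forall>i j. ((\<lambda>x. F x $ i $ j) \<longlongrightarrow> M $ i $ j) G"
    by (intro allI tendsto_vec_nth)
  show "\<forall>i j. ((\<lambda>x. F x $ i $ j) \<longlongrightarrow> M $ i $ j) G \<Longrightarrow> (F \<longlongrightarrow> M) G"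
    by (intro vec_tendstoI) blast
qed

lemma tendsto_mat2 [tendsto_intros]:
  assumes "(a \<longlongrightarrow> a') G" "(b \<longlongrightarrow> b') G" "(c \<longlongrightarrow> c') G" "(d \<longlongrightarrow> d') G"
  shows "((\<lambda>x. mat2 (a x) (b x) (c x) (d x)) \<longlongrightarrow> mat2 a' b' c' d') G"
  using assms by (simp add: tendsto_cmat2_iff forall_2)

lemma tendsto_cmat2_mult [tendsto_intros]:
  fixes F H :: "_ \<Rightarrow> cmat2"
  assumes "(F \<longlongrightarrow> M) G" "(H \<longlongrightarrow> N) G"
  shows "((\<lambda>x. F x ** H x) \<longlongrightarrow> M ** N) G"
  unfolding tendsto_cmat2_iff[of "\<lambda>x. F x ** H x"] cmat2_mult_nth
  by (intro allI tendsto_add tendsto_mult tendsto_vec_nth assms)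

lemma continuous_on_mat2 [continuous_intros]:
  assumes "continuous_on X a" "continuous_on X b" "continuous_on X c" "continuous_on X d"
  shows "continuous_on X (\<lambda>x. mat2 (a x) (b x) (c x) (d x))"
  using assms by (auto simp: continuous_on_def intro: tendsto_intros)

lemma continuous_on_cmat2_mult [continuous_intros]:
  fixes F H :: "_ \<Rightarrow> cmat2"
  assumes "continuous_on X F" "continuous_on X H"
  shows "continuous_on X (\<lambda>x. F x ** H x)"
  using assms by (auto simp: continuous_on_def intro: tendsto_intros)

lemma det_mat2 [simp]: "det (mat2 a b c d) = a * d - b * c"
  by (simp add: det_2)

lemma invertible_mat2_iff: "invertible (mat2 a b c d) \<longleftrightarrow> a * d - b * c \<noteq> 0"
  by (simp add: invertible_det_nz)

text \<open>\<open>matrix_inv\<close> is defined by choice; this is the only place where the choice is opened.\<close>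

lemma cmat2_matrix_inv:
  fixes M :: cmat2
  assumes "invertible M"
  shows "M ** matrix_inv M = mat 1" "matrix_inv M ** M = mat 1"
proof -
  have "\<exists>N. M ** N = mat 1 \<and> N ** M = mat 1"
    using assms by (simp add: invertible_def)
  then have "M ** matrix_inv M = mat 1 \<and> matrix_inv M ** M = mat 1"
    unfolding matrix_inv_def by (rule someI_ex)
  then show "M ** matrix_inv M = mat 1" "matrix_inv M ** M = mat 1" by simp_all
qed

text \<open>Cramer's rule, from which continuity and analyticity of the inverse are read off entry by entry.\<close>

lemma matrix_inv_cmat2:
  fixes M :: cmat2
  assumes "invertible M"
  shows "matrix_inv M = mat2 (M$2$2 / det M) (- M$1$2 / det M) (- M$2$1 / det M) (M$1$1 / det M)"
    (is "_ = ?N")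
proof -
  have d: "det M \<noteq> 0" using assms by (simp add: invertible_det_nz)
  have "?N ** M = mat 1" "M ** ?N = mat 1"
    using d by (simp_all add: cmat2_eq_iff cmat2_mult_nth add_divide_distrib[symmetric] diff_divide_distrib[symmetric])
      (simp_all add: det_2 mult.commute)
  have "matrix_inv M = (?N ** M) ** matrix_inv M"
    using \<open>?N ** M = mat 1\<close> by simp
  also have "\<dots> = ?N"
    by (simp add: cmat2_matrix_inv[OF assms] flip: matrix_mul_assoc)
  finally show ?thesis .
qed

lemma continuous_on_matrix_inv_cmat2:
  fixes F :: "'a::topological_space \<Rightarrow> cmat2"
  assumes F: "continuous_on X F" and inv: "\<And>x. x \<in> X \<Longrightarrow> invertible (F x)"
  shows "continuous_on X (\<lambda>x. matrix_inv (F x))"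
proof -
  have "continuous_on X (\<lambda>x. F x $ i $ j)" for i j
    using F by (intro continuous_intros)
  then have "continuous_on X (\<lambda>x. mat2 (F x$2$2 / det (F x)) (- F x$1$2 / det (F x))
      (- F x$2$1 / det (F x)) (F x$1$1 / det (F x)))"
    using inv unfolding det_2 invertible_det_nz
    by (intro continuous_on_mat2 continuous_on_divide continuous_on_minus continuous_on_diff continuous_on_mult) auto
  then show ?thesis
    by (rule continuous_on_eq) (simp add: inv matrix_inv_cmat2)
qed

lemma mat_analytic_on_mult:
  assumes "mat_analytic_on F D" "mat_analytic_on H D"
  shows "mat_analytic_on (\<lambda>z. F z ** H z) D"
  using assms unfolding mat_analytic_on_def cmat2_mult_nth by (auto intro!: analytic_intros)

lemma mat_analytic_on_mat2:
  assumes "a analytic_on D" "b analytic_on D" "c analytic_on D" "d analytic_on D"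
  shows "mat_analytic_on (\<lambda>x. mat2 (a x) (b x) (c x) (d x)) D"
  using assms by (simp add: mat_analytic_on_def forall_2)

lemma mat_analytic_on_matrix_inv:
  assumes F: "mat_analytic_on F D" and inv: "\<And>z. z \<in> D \<Longrightarrow> invertible (F z)" and "open D"
  shows "mat_analytic_on (\<lambda>z. matrix_inv (F z)) D"
proof -
  have F': "(\<lambda>z. F z $ i $ j) holomorphic_on D" for i j
    using F by (auto simp: mat_analytic_on_def intro: analytic_imp_holomorphic)
  have nz: "F z $ 1 $ 1 * F z $ 2 $ 2 - F z $ 1 $ 2 * F z $ 2 $ 1 \<noteq> 0" if "z \<in> D" for z
    using inv[OF that] by (simp add: invertible_det_nz det_2)
  have "(\<lambda>z. F z$k$l / det (F z)) holomorphic_on D" "(\<lambda>z. - F z$k$l / det (F z)) holomorphic_on D" for k l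
    unfolding det_2 using F' nz by (auto intro!: holomorphic_intros)
  then have "(\<lambda>z. mat2 (F z$2$2 / det (F z)) (- F z$1$2 / det (F z))
      (- F z$2$1 / det (F z)) (F z$1$1 / det (F z)) $ i $ j) holomorphic_on D" for i j
    using exhaust_2[of i] exhaust_2[of j] by auto
  then have "(\<lambda>z. matrix_inv (F z) $ i $ j) holomorphic_on D" for i j
    by (rule holomorphic_transform) (simp add: inv matrix_inv_cmat2)
  then show ?thesis
    using \<open>open D\<close> by (simp add: mat_analytic_on_def analytic_on_open)
qed

section \<open>The exponential of a matrix with a known eigenbasis\<close>

lemma mpow_0 [simp]: "mpow M 0 = mat 1" and mpow_Suc [simp]: "mpow M (Suc n) = M ** mpow M n"
  by (simp_all add: mpow_def)

lemma mpow_intertwine: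
  assumes "B ** M = mat2 x 0 0 y ** B"
  shows "B ** mpow M n = mat2 (x ^ n) 0 0 (y ^ n) ** B"
proof (induction n)
  case 0
  show ?case by (simp add: cmat2_eq_iff cmat2_mult_nth)
next
  case (Suc n)
  have "B ** mpow M (Suc n) = mat2 x 0 0 y ** (B ** mpow M n)"
    by (simp add: matrix_mul_assoc assms)
  also have "\<dots> = mat2 (x ^ Suc n) 0 0 (y ^ Suc n) ** B"
    by (simp add: Suc matrix_mul_assoc mat2_mult)
  finally show ?case .
qed

text \<open>The series for \<open>mexp\<close> is summed without a norm on matrices: \<open>B\<close> diagonalises \<open>M\<close>, so its partial sums
  are conjugate to diagonal matrices of partial sums of the scalar exponential series.\<close>

lemma mexp_intertwine:
  assumes "invertible B" and BM: "B ** M = mat2 x 0 0 y ** B"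
  shows "B ** mexp M = mat2 (exp x) 0 0 (exp y) ** B"
proof -
  let ?C = "matrix_inv B"
  have C: "?C ** B = mat 1" "B ** ?C = mat 1"
    using \<open>invertible B\<close> by (simp_all add: cmat2_matrix_inv)
  have pow: "mpow M n = ?C ** mat2 (x ^ n) 0 0 (y ^ n) ** B" for n
  proof -
    have "?C ** mat2 (x ^ n) 0 0 (y ^ n) ** B = ?C ** (B ** mpow M n)"
      by (simp add: mpow_intertwine[OF BM] matrix_mul_assoc)
    then show ?thesis by (simp add: matrix_mul_assoc C)
  qed
  have expo: "(\<lambda>n. \<Sum>k<n. z ^ k / fact k) \<longlonglongrightarrow> exp z" for z :: complex
    using exp_converges[of z] by (simp add: sums_def scaleR_conv_of_real divide_inverse mult.commute of_real_inverse)
  have sum_eq: "(\<Sum>k<n. (1 / fact k) *\<^sub>R mpow M k) =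
      ?C ** mat2 (\<Sum>k<n. x ^ k / fact k) 0 0 (\<Sum>k<n. y ^ k / fact k) ** B" for n
  proof (induction n)
    case 0
    show ?case by (simp add: cmat2_eq_iff cmat2_mult_nth)
  next
    case (Suc n)
    have add: "N ** mat2 (X + u) 0 0 (Y + v) ** B = N ** mat2 X 0 0 Y ** B + N ** mat2 u 0 0 v ** B"
      for N :: cmat2 and X Y u v
      by (simp add: cmat2_eq_iff cmat2_mult_nth algebra_simps)
    have scale: "N ** mat2 (u / r) 0 0 (v / r) ** B = (1 / r') *\<^sub>R (N ** mat2 u 0 0 v ** B)"
      if "r = of_real r'" for N :: cmat2 and u v r r'
      by (simp add: cmat2_eq_iff cmat2_mult_nth scaleR_conv_of_real[of _ "_ :: complex"] that add_divide_distrib)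
    show ?case
      by (simp add: Suc[unfolded pow] add pow scale[of "fact n" "fact n"])
  qed
  have "(\<lambda>n. \<Sum>k<n. (1 / fact k) *\<^sub>R mpow M k) \<longlonglongrightarrow> ?C ** mat2 (exp x) 0 0 (exp y) ** B"
    unfolding sum_eq by (intro tendsto_intros expo)
  then have "mexp M = ?C ** mat2 (exp x) 0 0 (exp y) ** B"
    unfolding mexp_def by (intro sums_unique[symmetric]) (simp add: sums_def)
  then have "B ** mexp M = (B ** ?C) ** mat2 (exp x) 0 0 (exp y) ** B"
    by (simp add: matrix_mul_assoc)
  then show ?thesis by (simp add: C)
qed

text \<open>The rows \<open>(1, s)\<close> and \<open>(1, - s)\<close> are left eigenvectors of \<open>Lambda z\<close> with eigenvalues \<open>\<plusminus> s\<close>. Only odd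
  powers occur in \<open>xi\<close>, hence the two eigenvalues of \<open>xi t z\<close> are opposite as well. The root \<open>s\<close> is an
  arbitrary one: on the cut to infinity, where the chosen branch of the root is undefined, the lemmas of
  this section are used with the principal root or with a local analytic root.\<close>

lemma Amat_intertwines_xi:
  fixes s z :: complex
  assumes s: "s\<^sup>2 = z"
  shows "mat2 1 s 1 (- s) ** xi t z =
     mat2 (theta t (\<lambda>_. s) z) 0 0 (- theta t (\<lambda>_. s) z) ** mat2 1 s 1 (- s)"
proof -
  let ?B = "mat2 1 s 1 (- s)"
  have L: "?B ** Lambda z = mat2 s 0 0 (- s) ** ?B"
    using s by (simp add: Lambda_def mat2_mult power2_eq_square)
  have mono: "?B ** (mat (t i) ** mpow (Lambda z) i) =
      mat2 (s * (t i * z ^ ((i - 1) div 2))) 0 0 (- (s * (t i * z ^ ((i - 1) div 2)))) ** ?B" if "odd i" for i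
  proof -
    obtain k where i: "i = 2 * k + 1" using \<open>odd i\<close> by (elim oddE)
    have p: "s ^ i = s * z ^ k" "(- s) ^ i = - (s * z ^ k)"
      by (simp_all add: i power_mult s)
    have "?B ** (mat (t i) ** mpow (Lambda z) i) = mat (t i) ** (?B ** mpow (Lambda z) i)"
      by (simp add: cmat2_eq_iff cmat2_mult_nth algebra_simps)
    then show ?thesis
      by (simp add: mpow_intertwine[OF L] p) (simp add: i cmat2_eq_iff cmat2_mult_nth mult_ac)
  qed
  have "?B ** xi t z = (\<Sum>i\<in>times_support t. ?B ** (mat (t i) ** mpow (Lambda z) i))"
    unfolding xi_def
    by (simp add: cmat2_eq_iff cmat2_mult_nth sum_distrib_left sum.distrib sum_subtractf sum_negf)
  also have "\<dots> = (\<Sum>i\<in>times_support t.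
      mat2 (s * (t i * z ^ ((i - 1) div 2))) 0 0 (- (s * (t i * z ^ ((i - 1) div 2)))) ** ?B)"
    by (intro sum.cong refl mono) (simp add: times_support_def)
  also have "\<dots> = mat2 (theta t (\<lambda>_. s) z) 0 0 (- theta t (\<lambda>_. s) z) ** ?B"
    by (simp add: theta_def cmat2_eq_iff cmat2_mult_nth sum_distrib_left sum_distrib_right sum_negf)
  finally show ?thesis .
qed

lemma Amat_mexp_xi:
  fixes s z :: complex and t :: "nat \<Rightarrow> complex"
  assumes s: "s\<^sup>2 = z" and z: "z \<noteq> 0"
  defines "\<theta> \<equiv> theta t (\<lambda>_. s) z"
  shows "mat2 1 s 1 (- s) ** mexp (xi t z) = mat2 (exp \<theta>) 0 0 (exp (- \<theta>)) ** mat2 1 s 1 (- s)"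
    and "mat2 1 s 1 (- s) ** mexp (- xi t z) = mat2 (exp (- \<theta>)) 0 0 (exp \<theta>) ** mat2 1 s 1 (- s)"
proof -
  let ?B = "mat2 1 s 1 (- s)"
  have "s \<noteq> 0" using s z by auto
  then have inv: "invertible ?B"
    by (simp add: invertible_mat2_iff)
  show "?B ** mexp (xi t z) = mat2 (exp \<theta>) 0 0 (exp (- \<theta>)) ** ?B"
    unfolding \<theta>_def by (rule mexp_intertwine[OF inv Amat_intertwines_xi[OF s]])
  have "?B ** (- xi t z) = - (?B ** xi t z)"
    by (simp add: cmat2_eq_iff cmat2_mult_nth)
  also have "\<dots> = mat2 (- \<theta>) 0 0 (- (- \<theta>)) ** ?B"
    unfolding Amat_intertwines_xi[OF s] by (simp add: cmat2_eq_iff cmat2_mult_nth \<theta>_def)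
  finally show "?B ** mexp (- xi t z) = mat2 (exp (- \<theta>)) 0 0 (exp \<theta>) ** ?B"
    using mexp_intertwine[OF inv] by fastforce
qed

lemma mexp_minus_xi:
  fixes s z :: complex
  assumes s: "s\<^sup>2 = z" and z: "z \<noteq> 0"
  shows "mexp (- xi t z) = mat2 (1/2) (1/2) (1 / (2 * s)) (- 1 / (2 * s)) **
     mat2 (exp (- theta t (\<lambda>_. s) z)) 0 0 (exp (theta t (\<lambda>_. s) z)) ** mat2 1 s 1 (- s)"
proof -
  have "s \<noteq> 0" using s z by auto
  then have "mat2 (1/2) (1/2) (1 / (2 * s)) (- 1 / (2 * s)) ** mat2 1 s 1 (- s) = mat 1"
    by (simp add: cmat2_eq_iff cmat2_mult_nth)
  then have "mexp (- xi t z) = mat2 (1/2) (1/2) (1 / (2 * s)) (- 1 / (2 * s)) ** (mat2 1 s 1 (- s) ** mexp (- xi t z))"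
    by (simp add: matrix_mul_assoc)
  then show ?thesis
    unfolding Amat_mexp_xi(2)[OF s z] by (simp add: matrix_mul_assoc)
qed

lemma mexp_xi_inverse:
  assumes "z \<noteq> 0"
  shows "mexp (- xi t z) ** mexp (xi t z) = mat 1"
proof -
  define s where "s = csqrt z"
  have s: "s\<^sup>2 = z" by (simp add: s_def)
  let ?B = "mat2 1 s 1 (- s)" and ?\<theta> = "theta t (\<lambda>_. s) z"
  have "s \<noteq> 0" using s assms by auto
  then have inv: "invertible ?B" by (simp add: invertible_mat2_iff)
  have "?B ** (mexp (- xi t z) ** mexp (xi t z)) = mat2 (exp (- ?\<theta>)) 0 0 (exp ?\<theta>) ** (?B ** mexp (xi t z))"
    by (simp add: matrix_mul_assoc Amat_mexp_xi(2)[OF s assms])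
  also have "\<dots> = ?B"
    by (simp add: matrix_mul_assoc Amat_mexp_xi(1)[OF s assms] mat2_mult exp_minus field_simps)
  finally have "(matrix_inv ?B ** ?B) ** (mexp (- xi t z) ** mexp (xi t z)) = matrix_inv ?B ** ?B"
    by (simp flip: matrix_mul_assoc)
  then show ?thesis by (simp add: cmat2_matrix_inv[OF inv])
qed

text \<open>No square root of \<open>z\<close> is continuous on the whole punctured plane, but the formula for \<open>mexp (- xi t z)\<close>
  holds for either root, and near \<open>z0\<close> an analytic one can be taken.\<close>

lemma isCont_mexp_minus_xi:
  assumes "z0 \<noteq> 0"
  shows "isCont (\<lambda>z. mexp (- xi t z)) z0"
proof -
  have nz: "z \<noteq> 0" if "z \<in> ball z0 (cmod z0)" for z
    using that by auto
  obtain s where s: "s holomorphic_on ball z0 (cmod z0)" "\<And>z. z \<in> ball z0 (cmod z0) \<Longrightarrow> z = (s z)\<^sup>2"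
  proof (rule contractible_imp_holomorphic_sqrt)
    show "(\<lambda>z. z) holomorphic_on ball z0 (cmod z0)" by (rule holomorphic_on_ident)
    show "contractible (ball z0 (cmod z0))" by (simp add: convex_imp_contractible)
  qed (use nz in auto)
  have sc: "continuous_on (ball z0 (cmod z0)) s"
    using s(1) by (rule holomorphic_on_imp_continuous_on)
  have snz: "s z \<noteq> 0" if "z \<in> ball z0 (cmod z0)" for z
    using s(2)[OF that] nz[OF that] by auto
  have "continuous_on (ball z0 (cmod z0)) (\<lambda>z. mat2 (1/2) (1/2) (1 / (2 * s z)) (- 1 / (2 * s z)) **
     mat2 (exp (- theta t (\<lambda>_. s z) z)) 0 0 (exp (theta t (\<lambda>_. s z) z)) ** mat2 1 (s z) 1 (- s z))"
    unfolding theta_def using snz by (intro continuous_intros sc) auto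
  then have "continuous_on (ball z0 (cmod z0)) (\<lambda>z. mexp (- xi t z))"
    by (rule continuous_on_eq) (use s(2) nz in \<open>metis mexp_minus_xi\<close>)
  then show ?thesis
    using assms by (simp add: continuous_on_eq_continuous_at)
qed

section \<open>Square roots of holomorphic functions\<close>

text \<open>The quotient \<open>f / p\<close> is continuous with values in the discrete set \<open>{1, -1}\<close>.\<close>

lemma sqrt_sign_constant:
  fixes f p :: "'a::topological_space \<Rightarrow> complex"
  assumes "connected X" and "continuous_on X f" and "continuous_on X p"
    and "\<And>x. x \<in> X \<Longrightarrow> (f x)\<^sup>2 = (p x)\<^sup>2" and "\<And>x. x \<in> X \<Longrightarrow> p x \<noteq> 0"
  obtains e where "e \<in> {1, -1}" and "\<And>x. x \<in> X \<Longrightarrow> f x = e * p x"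
proof -
  let ?h = "\<lambda>x. f x / p x"
  have sq: "?h x \<in> {1, -1}" if "x \<in> X" for x
  proof -
    have "(?h x)\<^sup>2 = 1"
      using that assms(4,5) by (simp add: power_divide)
    then show ?thesis by (simp add: power2_eq_1_iff)
  qed
  have "continuous_on X ?h"
    using assms by (intro continuous_intros) auto
  then have "connected (?h ` X)"
    using \<open>connected X\<close> by (rule connected_continuous_image)
  moreover have "finite (?h ` X)"
    by (rule finite_subset[of _ "{1, -1}"]) (use sq in blast, simp)
  ultimately consider "X = {}" | w where "?h ` X = {w}"
    using connected_finite_iff_sing by blast
  then show ?thesis
  proof cases
    case 1
    then show ?thesis using that[of 1] by auto
  next
    case 2
    then have w: "?h x = w" if "x \<in> X" for x using that by blast
    moreover have "X \<noteq> {}" using 2 by auto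
    ultimately have "w \<in> {1, -1}" using sq by blast
    moreover have "f x = w * p x" if "x \<in> X" for x
      using w[OF that] assms(5)[OF that] by (simp add: field_simps)
    ultimately show ?thesis using that by blast
  qed
qed

text \<open>Local continuations of \<open>R\<close> across \<open>K\<close> fit together because \<open>K\<close> has no interior points in \<open>B\<close>: at a point
  of \<open>K\<close> every continuation must take the limiting value of \<open>R\<close> along the complement of \<open>K\<close>.\<close>

lemma holomorphic_glue_across:
  fixes R :: "complex \<Rightarrow> complex"
  assumes "open B" and "closed K" and dense: "B \<subseteq> closure (- K)"
    and loc: "\<And>z. z \<in> B \<Longrightarrow> \<exists>\<eta>>0. \<exists>f. f holomorphic_on ball z \<eta> \<and> (\<forall>w\<in>ball z \<eta> - K. R w = f w)"
  obtains F where "F holomorphic_on B" and "\<And>z. z \<in> B - K \<Longrightarrow> F z = R z"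
proof -
  define F where "F = (\<lambda>z. Lim (at z within - K) R)"
  have nontriv: "at w within - K \<noteq> bot" if "w \<in> B" for w
  proof -
    have "w islimpt - K"
    proof (cases "w \<in> K")
      case True
      then show ?thesis using dense that by (auto simp: closure_def)
    next
      case False
      then show ?thesis using \<open>closed K\<close> by (intro open_imp_islimpt) auto
    qed
    then show ?thesis by (simp add: trivial_limit_within)
  qed
  have F_eq: "F w = f w"
    if f: "f holomorphic_on ball z \<eta>" "\<forall>w\<in>ball z \<eta> - K. R w = f w" and w: "w \<in> B" "w \<in> ball z \<eta>" for f z \<eta> w
  proof -
    have "continuous (at w within - K) f"
      using f(1) w(2) by (metis continuous_at_imp_continuous_at_within continuous_on_interior
          holomorphic_on_imp_continuous_on interior_open open_ball)
    then have "(f \<longlongrightarrow> f w) (at w within - K)"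
      by (simp add: continuous_within)
    moreover have "\<forall>\<^sub>F x in at w within - K. f x = R x"
    proof -
      have "\<forall>\<^sub>F x in at w within - K. x \<in> ball z \<eta>"
        using w(2) by (intro topological_tendstoD[OF tendsto_ident_at]) auto
      moreover have "\<forall>\<^sub>F x in at w within - K. x \<in> - K"
        by (simp add: eventually_at_filter)
      ultimately show ?thesis
        by eventually_elim (use f(2) in auto)
    qed
    ultimately have "(R \<longlongrightarrow> f w) (at w within - K)"
      by (rule Lim_transform_eventually)
    then show ?thesis
      unfolding F_def using nontriv[OF w(1)] by (simp add: tendsto_Lim)
  qed
  show ?thesis
  proof
    have "F field_differentiable at z" if zB: "z \<in> B" for z
    proof -
      obtain \<eta> f where \<eta>: "\<eta> > 0" and f: "f holomorphic_on ball z \<eta>" "\<forall>w\<in>ball z \<eta> - K. R w = f w"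
        using loc[OF zB] by blast
      have "f field_differentiable at z"
        using f(1) \<eta> by (simp add: holomorphic_on_imp_differentiable_at)
      then obtain d where d: "(f has_field_derivative d) (at z)"
        by (auto simp: field_differentiable_def)
      have "(F has_field_derivative d) (at z)"
        by (rule has_field_derivative_transform_within_open[OF d, of "ball z \<eta> \<inter> B"])
          (use F_eq[OF f] \<eta> zB \<open>open B\<close> in auto)
      then show ?thesis by (auto simp: field_differentiable_def)
    qed
    then show "F holomorphic_on B"
      by (simp add: holomorphic_onI field_differentiable_at_within)
    show "F z = R z" if z: "z \<in> B - K" for z
    proof -
      obtain \<eta> f where "\<eta> > 0" and f: "f holomorphic_on ball z \<eta>" "\<forall>w\<in>ball z \<eta> - K. R w = f w"
        using loc z by blast
      then show ?thesis using F_eq[OF f, of z] z by auto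
    qed
  qed
qed

text \<open>Since \<open>F\<^sup>2 = P\<close> tends to \<open>0\<close>, the singularity of \<open>F\<close> is removable with value \<open>0\<close>, and then the derivative
  \<open>2 F F'\<close> of \<open>P\<close> vanishes at \<open>e\<close>.\<close>

lemma no_holomorphic_sqrt_at_simple_zero:
  assumes "\<eta> > 0" and F: "F holomorphic_on ball e \<eta> - {e}"
    and sq: "\<And>z. z \<in> ball e \<eta> - {e} \<Longrightarrow> (F z)\<^sup>2 = P z"
    and P: "(P has_field_derivative d) (at e)" "P e = 0" "d \<noteq> 0"
  shows False
proof -
  have "(P \<longlongrightarrow> 0) (at e)"
    using DERIV_isCont[OF P(1)] P(2) by (simp add: isCont_def)
  moreover have ev: "\<forall>\<^sub>F z in at e. z \<in> ball e \<eta> - {e}"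
    using \<open>\<eta> > 0\<close> by (intro eventually_at_in_open) auto
  then have "\<forall>\<^sub>F z in at e. P z = (F z)\<^sup>2"
    by eventually_elim (use sq in auto)
  ultimately have "((\<lambda>z. (F z)\<^sup>2) \<longlongrightarrow> 0) (at e)"
    by (rule Lim_transform_eventually)
  then have F0: "(F \<longlongrightarrow> 0) (at e)"     using tendsto_norm_zero[of "\<lambda>z. (F z)\<^sup>2" "at e"] power_tendsto_0_iff[of 2 "\<lambda>z. norm (F z)" "at e"]
    by (simp add: norm_power tendsto_norm_zero_iff)
  then have "((\<lambda>z. (z - e) * F z) \<longlongrightarrow> 0) (at e)"
    by (auto intro!: tendsto_eq_intros)
  then obtain G where G: "G holomorphic_on ball e \<eta>" "\<forall>z\<in>ball e \<eta> - {e}. G z = F z"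
    using holomorphic_on_extend_lim[OF F] \<open>\<eta> > 0\<close> by (auto simp: interior_open)
  have Gd: "G field_differentiable at e"
    using G(1) \<open>\<eta> > 0\<close> by (simp add: holomorphic_on_imp_differentiable_at)
  then obtain d' where d': "(G has_field_derivative d') (at e)"
    by (auto simp: field_differentiable_def)
  have "(G \<longlongrightarrow> G e) (at e)"
    using DERIV_isCont[OF d'] by (simp add: isCont_def)
  moreover have "\<forall>\<^sub>F z in at e. F z = G z"
    using ev by eventually_elim (use G(2) in auto)
  then have "(G \<longlongrightarrow> 0) (at e)"
    using F0 by (rule Lim_transform_eventually[rotated])
  ultimately have "G e = 0"
    using LIM_unique by blast
  then have "G z * G z = P z" if "z \<in> ball e \<eta>" for z
    using that sq[of z] G(2) P(2) by (cases "z = e") (auto simp: power2_eq_square)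
  moreover have "((\<lambda>z. G z * G z) has_field_derivative 0) (at e)"
    using DERIV_mult[OF d' d'] \<open>G e = 0\<close> by simp
  ultimately have "(P has_field_derivative 0) (at e)"
    using \<open>\<eta> > 0\<close> by (elim has_field_derivative_transform_within_open[of _ _ _ "ball e \<eta>"]) auto
  then show False
    using DERIV_unique[OF _ P(1)] P(3) by blast
qed

section \<open>A square root changes sign across a slit\<close>

definition side_point :: "(real \<Rightarrow> complex) \<Rightarrow> real \<Rightarrow> real \<Rightarrow> complex" where
  "side_point c s r = c s + of_real r * (\<i> * vector_derivative c (at s))"

text \<open>A one-sided limit in the sense of \<open>has_left_limit\<close> is a limit along this filter, which makes the general
  limit calculus applicable to it.\<close>

definition left_side :: "(real \<Rightarrow> complex) \<Rightarrow> real \<Rightarrow> complex filter" where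
  "left_side c s = filtermap (\<lambda>(s, r). side_point c s r) (nhds s \<times>\<^sub>F at_right 0)"

definition right_side :: "(real \<Rightarrow> complex) \<Rightarrow> real \<Rightarrow> complex filter" where
  "right_side c s = filtermap (\<lambda>(s, r). side_point c s (- r)) (nhds s \<times>\<^sub>F at_right 0)"

lemma has_left_limit_iff: "has_left_limit F M c s \<longleftrightarrow> (F \<longlongrightarrow> M) (left_side c s)"
  unfolding has_left_limit_def left_side_def filterlim_filtermap side_point_def
  by (simp add: case_prod_unfold)

lemma has_right_limit_iff: "has_right_limit F M c s \<longleftrightarrow> (F \<longlongrightarrow> M) (right_side c s)"
  unfolding has_right_limit_def right_side_def filterlim_filtermap side_point_def
  by (simp add: case_prod_unfold)

lemma side_ne_bot [simp]: "left_side c s \<noteq> bot" "right_side c s \<noteq> bot"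
  by (simp_all add: left_side_def right_side_def filtermap_bot_iff prod_filter_eq_bot
      trivial_limit_at_right_real)

lemma eventually_sides:
  assumes "\<delta> > 0"
  shows "(\<And>s' r. \<bar>s' - s\<bar> < \<delta> \<Longrightarrow> 0 < r \<Longrightarrow> r < \<delta> \<Longrightarrow> Q (side_point c s' r)) \<Longrightarrow> eventually Q (left_side c s)"
    and "(\<And>s' r. \<bar>s' - s\<bar> < \<delta> \<Longrightarrow> 0 < r \<Longrightarrow> r < \<delta> \<Longrightarrow> Q (side_point c s' (- r))) \<Longrightarrow> eventually Q (right_side c s)"
proof -
  have 1: "\<forall>\<^sub>F s' in nhds s. \<bar>s' - s\<bar> < \<delta>"
    using assms by (auto simp: eventually_nhds_metric dist_real_def)
  have 2: "\<forall>\<^sub>F r in at_right 0. 0 < r \<and> r < \<delta>"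
    using assms by (auto simp: eventually_at_right_field)
  have 3: "\<forall>\<^sub>F x in nhds s \<times>\<^sub>F at_right 0. \<bar>fst x - s\<bar> < \<delta> \<and> 0 < snd x \<and> snd x < \<delta>"
    using eventually_prodI[OF 1 2] by (simp add: case_prod_unfold)
  show "eventually Q (left_side c s)"
    if "\<And>s' r. \<bar>s' - s\<bar> < \<delta> \<Longrightarrow> 0 < r \<Longrightarrow> r < \<delta> \<Longrightarrow> Q (side_point c s' r)"
    unfolding left_side_def eventually_filtermap using 3
    by eventually_elim (use that in auto)
  show "eventually Q (right_side c s)"
    if "\<And>s' r. \<bar>s' - s\<bar> < \<delta> \<Longrightarrow> 0 < r \<Longrightarrow> r < \<delta> \<Longrightarrow> Q (side_point c s' (- r))"
    unfolding right_side_def eventually_filtermap using 3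
    by eventually_elim (use that in auto)
qed

text \<open>One arc \<open>c\<close> of a larger closed set \<open>K\<close> of cuts. The arc need not be regular at the parameter \<open>1\<close>, where it
  ends in a point or runs to infinity. The last assumption says that \<open>K\<close> looks like a single piece of \<open>c\<close> near
  each point of the arc, the initial point \<open>c 0\<close> included: no other cut accumulates there and the arc does not
  come back.\<close>

locale regular_slit =
  fixes K :: "complex set" and c :: "real \<Rightarrow> complex"
  assumes closed_K: "closed K"
    and in_K: "c ` {0..<1} \<subseteq> K"
    and cont: "continuous_on {0..<1} c"
    and inj: "inj_on c {0..<1}"
    and C1: "c C1_differentiable_on {0<..<1}"
    and regular: "\<And>s. s \<in> {0<..<1} \<Longrightarrow> vector_derivative c (at s) \<noteq> 0"
    and isolated: "\<And>s \<delta>. s \<in> {0..<1} \<Longrightarrow> \<delta> > 0 \<Longrightarrow>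
      \<exists>\<eta>>0. K \<inter> ball (c s) \<eta> \<subseteq> c ` ({0..<1} \<inter> {s - \<delta><..<s + \<delta>})"
begin

abbreviation vel :: "real \<Rightarrow> complex" where "vel s \<equiv> vector_derivative c (at s)"

lemma has_vel: "s \<in> {0<..<1} \<Longrightarrow> (c has_vector_derivative vel s) (at s)"
  using C1 by (auto simp: C1_differentiable_on_eq vector_derivative_works)

lemma vel_cont: "continuous_on {0<..<1} vel"
  using C1 by (auto simp: C1_differentiable_on_eq)

text \<open>The derivative is continuous, so near \<open>s\<close> velocities and chords differ little from the
  tangent at \<open>s\<close>. The relative error \<open>1/4\<close> is small enough for the comparison of real and imaginary parts in
  \<open>side_points_avoid\<close>.\<close>

lemma vel_close:
  assumes s: "s \<in> {0<..<1}"
  obtains \<delta> where "\<delta> > 0" and "{s - \<delta><..<s + \<delta>} \<subseteq> {0<..<1}"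
    and "\<And>u. u \<in> {s - \<delta><..<s + \<delta>} \<Longrightarrow> cmod (vel u - vel s) \<le> cmod (vel s) / 4"
    and "\<And>u v. u \<in> {s - \<delta><..<s + \<delta>} \<Longrightarrow> v \<in> {s - \<delta><..<s + \<delta>} \<Longrightarrow>
           cmod (c v - c u - (v - u) *\<^sub>R vel s) \<le> cmod (vel s) / 4 * \<bar>v - u\<bar>"
proof -
  have "isCont vel s"
    using vel_cont s by (simp add: continuous_on_eq_continuous_at)
  moreover have "cmod (vel s) / 4 > 0"
    using regular[OF s] by simp
  ultimately obtain \<delta>1 where \<delta>1: "\<delta>1 > 0" "\<And>u. \<bar>u - s\<bar> < \<delta>1 \<Longrightarrow> dist (vel u) (vel s) < cmod (vel s) / 4"
    unfolding continuous_at_eps_delta dist_real_def by metis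
  define \<delta> where "\<delta> = min \<delta>1 (min s (1 - s))"
  have pos: "\<delta> > 0" and sub: "{s - \<delta><..<s + \<delta>} \<subseteq> {0<..<1}"
    using s \<delta>1 by (auto simp: \<delta>_def)
  have bd: "cmod (vel u - vel s) \<le> cmod (vel s) / 4" if "u \<in> {s - \<delta><..<s + \<delta>}" for u
    using \<delta>1(2)[of u] that by (force simp: \<delta>_def dist_norm abs_less_iff intro: less_imp_le)
  have "cmod (c v - c u - (v - u) *\<^sub>R vel s) \<le> cmod (vel s) / 4 * \<bar>v - u\<bar>"
    if uv: "u \<in> {s - \<delta><..<s + \<delta>}" "v \<in> {s - \<delta><..<s + \<delta>}" for u v
  proof -
    let ?I = "{s - \<delta><..<s + \<delta>}"
    let ?h = "\<lambda>x. c x - x *\<^sub>R vel s"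
    have der: "(?h has_derivative (\<lambda>x. x *\<^sub>R (vel x0 - vel s))) (at x0 within ?I)" if "x0 \<in> ?I" for x0
    proof -
      have "(c has_derivative (\<lambda>x. x *\<^sub>R vel x0)) (at x0 within ?I)"
        using has_vel[of x0] that sub
        by (auto simp: has_vector_derivative_def has_derivative_at_withinI)
      then show ?thesis
        by (auto intro!: derivative_eq_intros simp: algebra_simps)
    qed
    have "cmod (?h v - ?h u) \<le> cmod (vel s) / 4 * norm (v - u)"
    proof (rule differentiable_bound[OF _ der])
      show "onorm (\<lambda>x. x *\<^sub>R (vel x0 - vel s)) \<le> cmod (vel s) / 4" if "x0 \<in> ?I" for x0
        using mult_left_mono[OF bd[OF that]] by (intro onorm_le) (simp add: mult.commute)
    qed (use uv in auto)
    then show ?thesis by (simp add: algebra_simps)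
  qed
  then show ?thesis
    using that pos sub bd by blast
qed

lemma side_point_continuous: "continuous_on ({0<..<1} \<times> UNIV) (\<lambda>(s, r). side_point c s r)"
proof -
  have "continuous_on {0<..<1} c"
    using cont by (rule continuous_on_subset) auto
  then have "continuous_on ({0<..<1} \<times> (UNIV::real set)) (\<lambda>x. c (fst x))"
    by (rule continuous_on_compose2) (auto intro: continuous_intros)
  moreover have "continuous_on ({0<..<1} \<times> (UNIV::real set)) (\<lambda>x. vel (fst x))"
    by (rule continuous_on_compose2[OF vel_cont]) (auto intro: continuous_intros)
  ultimately show ?thesis
    unfolding side_point_def case_prod_unfold by (intro continuous_intros)
qed

text \<open>If \<open>side_point c u r = c w\<close> with \<open>u\<close> and \<open>w\<close> close to \<open>s\<close>, then the chord \<open>c w - c u\<close>, which is almost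
  parallel to the tangent at \<open>s\<close>, equals \<open>r \<i> c'(u)\<close>, which is almost perpendicular to it. Dividing by \<open>c'(s)\<close>
  and comparing real and imaginary parts leaves only \<open>r = 0\<close>.\<close>

lemma side_points_avoid:
  assumes s: "s \<in> {0<..<1}" and "\<eta> > 0"
  obtains \<delta> where "\<delta> > 0" and "{s - \<delta><..<s + \<delta>} \<subseteq> {0<..<1}"
    and "\<And>u r. \<bar>u - s\<bar> < \<delta> \<Longrightarrow> \<bar>r\<bar> < \<delta> \<Longrightarrow> side_point c u r \<in> ball (c s) \<eta>"
    and "\<And>u r. \<bar>u - s\<bar> < \<delta> \<Longrightarrow> \<bar>r\<bar> < \<delta> \<Longrightarrow> r \<noteq> 0 \<Longrightarrow> side_point c u r \<notin> K"
proof -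
  obtain \<delta>1 where \<delta>1: "\<delta>1 > 0" "{s - \<delta>1<..<s + \<delta>1} \<subseteq> {0<..<1}"
    and v: "\<And>u. u \<in> {s - \<delta>1<..<s + \<delta>1} \<Longrightarrow> cmod (vel u - vel s) \<le> cmod (vel s) / 4"
    and d: "\<And>u v. u \<in> {s - \<delta>1<..<s + \<delta>1} \<Longrightarrow> v \<in> {s - \<delta>1<..<s + \<delta>1} \<Longrightarrow>
           cmod (c v - c u - (v - u) *\<^sub>R vel s) \<le> cmod (vel s) / 4 * \<bar>v - u\<bar>"
    by (rule vel_close[OF s]) (rule that)
  obtain \<eta>1 where \<eta>1: "\<eta>1 > 0" "K \<inter> ball (c s) \<eta>1 \<subseteq> c ` ({0..<1} \<inter> {s - \<delta>1<..<s + \<delta>1})"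
    using isolated[of s \<delta>1] s \<delta>1(1) by auto
  define \<eta>2 where "\<eta>2 = min \<eta> \<eta>1"
  have "isCont (\<lambda>(s, r). side_point c s r) (s, 0)"
    using side_point_continuous s
    by (subst (asm) continuous_on_eq_continuous_at) (auto intro!: open_Times)
  moreover have "\<eta>2 > 0" using \<open>\<eta> > 0\<close> \<eta>1 by (simp add: \<eta>2_def)
  moreover have "side_point c s 0 = c s" by (simp add: side_point_def)
  ultimately obtain \<delta>2 where \<delta>2: "\<delta>2 > 0"
    "\<And>x. dist x (s, 0) < \<delta>2 \<Longrightarrow> dist (case x of (s, r) \<Rightarrow> side_point c s r) (c s) < \<eta>2"
    unfolding continuous_at_eps_delta by (metis case_prod_conv)
  define \<delta> where "\<delta> = min \<delta>1 (\<delta>2 / 2)"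
  have near: "side_point c u r \<in> ball (c s) \<eta>2" if "\<bar>u - s\<bar> < \<delta>" "\<bar>r\<bar> < \<delta>" for u r
  proof -
    have "dist (u, r) (s, 0) \<le> \<bar>u - s\<bar> + \<bar>r\<bar>"
      using sqrt_sum_squares_le_sum_abs[of "u - s" r] by (simp add: dist_Pair_Pair dist_real_def)
    also have "\<dots> < \<delta>2" using that by (simp add: \<delta>_def)
    finally show ?thesis using \<delta>2(2)[of "(u, r)"] by (simp add: dist_commute)
  qed
  have "side_point c u r \<notin> K" if ur: "\<bar>u - s\<bar> < \<delta>" "\<bar>r\<bar> < \<delta>" "r \<noteq> 0" for u r
  proof
    assume "side_point c u r \<in> K"
    then obtain w where w: "w \<in> {s - \<delta>1<..<s + \<delta>1}" and eq: "side_point c u r = c w"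
      using near[OF ur(1,2)] \<eta>1(2) by (auto simp: \<eta>2_def)
    have u: "u \<in> {s - \<delta>1<..<s + \<delta>1}" using ur by (auto simp: \<delta>_def)
    have nz: "vel s \<noteq> 0" using regular[OF s] .
    define e1 where "e1 = vel u / vel s - 1"
    define e2 where "e2 = (c w - c u - (w - u) *\<^sub>R vel s) / vel s"
    have "cmod e1 = cmod (vel u - vel s) / cmod (vel s)"
      using nz by (simp add: e1_def norm_divide[symmetric] diff_divide_distrib)
    then have e1: "cmod e1 \<le> 1/4"
      using v[OF u] nz by (simp add: divide_le_eq)
    have e2: "cmod e2 \<le> \<bar>w - u\<bar> / 4"
      using d[OF u w] nz by (simp add: e2_def norm_divide divide_le_eq mult.commute)
    \<comment> \<open>\<open>e1\<close> and \<open>e2\<close> are the relative errors of velocity and chord with respect to the tangent at \<open>s\<close>\<close>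
    have "of_real r * (\<i> * vel u) = c w - c u"
      using eq by (simp add: side_point_def algebra_simps)
    moreover have "vel u = vel s * (1 + e1)" using nz by (simp add: e1_def)
    moreover have "c w - c u = vel s * (of_real (w - u) + e2)"
      using nz by (simp add: e2_def field_simps scaleR_conv_of_real)
    ultimately have "vel s * (of_real r * \<i> * (1 + e1)) = vel s * (of_real (w - u) + e2)"
      by (simp add: algebra_simps)
    then have E: "of_real r * \<i> * (1 + e1) = of_real (w - u) + e2"
      using nz by simp
    have re: "- r * Im e1 = (w - u) + Re e2" using arg_cong[OF E, of Re] by (simp add: algebra_simps)
    have im: "r * (1 + Re e1) = Im e2" using arg_cong[OF E, of Im] by (simp add: algebra_simps)
    have "\<bar>r\<bar> * (3/4) \<le> \<bar>r\<bar> * \<bar>1 + Re e1\<bar>"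
      using abs_Re_le_cmod[of e1] e1 by (intro mult_left_mono) auto
    also have "\<dots> \<le> \<bar>w - u\<bar> / 4"
      using im abs_Im_le_cmod[of e2] e2 by (simp flip: abs_mult)
    finally have A: "\<bar>r\<bar> * 3 \<le> \<bar>w - u\<bar>" by simp
    have "\<bar>r * Im e1\<bar> \<le> \<bar>r\<bar> * (1/4)"
      unfolding abs_mult using abs_Im_le_cmod[of e1] e1 by (intro mult_left_mono) auto
    moreover have "\<bar>w - u\<bar> \<le> \<bar>r * Im e1\<bar> + \<bar>Re e2\<bar>"
      using re by simp
    ultimately have "\<bar>w - u\<bar> * 3 \<le> \<bar>r\<bar>"
      using abs_Re_le_cmod[of e2] e2 by simp
    moreover have "\<bar>r\<bar> > 0" using \<open>r \<noteq> 0\<close> by simp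
    moreover have False if "D * 3 \<le> x" "0 < x" "x * 3 \<le> D" for D x :: real
      using that by linarith
    ultimately show False using A by blast
  qed
  moreover have "side_point c u r \<in> ball (c s) \<eta>" if "\<bar>u - s\<bar> < \<delta>" "\<bar>r\<bar> < \<delta>" for u r
    using near[OF that] by (simp add: \<eta>2_def)
  moreover have "\<delta> > 0" using \<delta>1(1) \<delta>2(1) by (simp add: \<delta>_def)
  moreover have "{s - \<delta><..<s + \<delta>} \<subseteq> {s - \<delta>1<..<s + \<delta>1}" by (auto simp: \<delta>_def)
  ultimately show ?thesis
    using that[of \<delta>] \<delta>1(2) by (meson subset_trans)
qed

text \<open>A point \<open>z\<close> near \<open>c s\<close> has a nearest point \<open>c u\<close> on a short closed piece of the arc. For \<open>z\<close> close enough
  to \<open>c s\<close> this is not an end of the piece, hence \<open>z - c u\<close> is perpendicular to \<open>c'(u)\<close>. A tubular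
  neighbourhood theorem does not apply here: the arc is only \<open>C\<^sup>1\<close>, and its normal field need not be
  differentiable.\<close>

lemma side_points_cover:
  assumes s: "s \<in> {0<..<1}" and "\<delta> > 0"
  obtains \<eta> where "\<eta> > 0"
    and "\<And>z. z \<in> ball (c s) \<eta> \<Longrightarrow> \<exists>u r. \<bar>u - s\<bar> < \<delta> \<and> \<bar>r\<bar> < \<delta> \<and> z = side_point c u r"
proof -
  obtain \<delta>1 where \<delta>1: "\<delta>1 > 0" "{s - \<delta>1<..<s + \<delta>1} \<subseteq> {0<..<1}"
    and v: "\<And>u. u \<in> {s - \<delta>1<..<s + \<delta>1} \<Longrightarrow> cmod (vel u - vel s) \<le> cmod (vel s) / 4"
    by (rule vel_close[OF s]) (rule that)
  define d where "d = min \<delta> \<delta>1 / 2"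
  have d: "d > 0" "d < \<delta>" "d < \<delta>1" using \<open>\<delta> > 0\<close> \<delta>1(1) by (auto simp: d_def)
  let ?I = "{s - d..s + d}"
  have "?I \<subseteq> {s - \<delta>1<..<s + \<delta>1}" using d by auto
  then have I: "?I \<subseteq> {0<..<1}" using \<delta>1(2) by (rule subset_trans)
  have ends: "s - d \<in> {0..<1}" "s + d \<in> {0..<1}" "s \<in> {0..<1}"
    using subsetD[OF I, of "s - d"] subsetD[OF I, of "s + d"] s d(1) by auto
  define m where "m = cmod (vel s)"
  have m: "m > 0" using regular[OF s] by (simp add: m_def)
  define b where "b = min (dist (c s) (c (s - d))) (dist (c s) (c (s + d)))"
  have "c s \<noteq> c (s - d)" "c s \<noteq> c (s + d)"
    using inj_onD[OF inj _ ends(3,1)] inj_onD[OF inj _ ends(3,2)] d(1) by auto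
  then have "b > 0" by (simp add: b_def)
  define \<eta> where "\<eta> = min (b / 2) (m * d / 4)"
  have \<eta>: "\<eta> > 0" using \<open>b > 0\<close> m d by (simp add: \<eta>_def)
  have "?I \<subseteq> {0..<1}" using I by (rule subset_trans) auto
  with cont have contI: "continuous_on ?I c" by (rule continuous_on_subset)
  have "\<exists>u r. \<bar>u - s\<bar> < \<delta> \<and> \<bar>r\<bar> < \<delta> \<and> z = side_point c u r" if z: "z \<in> ball (c s) \<eta>" for z
  proof -
    have "continuous_on ?I (\<lambda>u. dist z (c u))"
      using contI by (intro continuous_intros)
    then obtain u where u: "u \<in> ?I" and min: "\<And>w. w \<in> ?I \<Longrightarrow> dist z (c u) \<le> dist z (c w)"
      using continuous_attains_inf[of ?I "\<lambda>u. dist z (c u)"] d(1) by (auto simp: Bex_def)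
    have near: "dist z (c u) < \<eta>"
      using min[of s] d z by (simp add: dist_commute)
    have "dist (c s) (c u) < b"
      using dist_triangle[of "c s" "c u" z] near z by (simp add: \<eta>_def dist_commute)
    then have ne: "u \<noteq> s - d" "u \<noteq> s + d" by (auto simp: b_def)
    then have u': "u \<in> {s - d<..<s + d}" using u by auto
    have u01: "u \<in> {0<..<1}" using u I by blast
    \<comment> \<open>at the nearest point the chord is orthogonal to the velocity\<close>
    let ?f = "\<lambda>x. (z - c x) \<bullet> (z - c x)"
    have "(?f has_derivative (\<lambda>x. (z - c u) \<bullet> (- (x *\<^sub>R vel u)) + (- (x *\<^sub>R vel u)) \<bullet> (z - c u))) (at u)"
      using has_vel[OF u01] unfolding has_vector_derivative_def
      by (auto intro!: derivative_eq_intros)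
    then have "(?f has_real_derivative (-2 * ((z - c u) \<bullet> vel u))) (at u)"
      unfolding has_field_derivative_def
      by (rule has_derivative_eq_rhs) (auto simp: inner_commute algebra_simps)
    moreover have "\<forall>y. \<bar>u - y\<bar> < min (u - (s - d)) (s + d - u) \<longrightarrow> ?f u \<le> ?f y"
    proof (intro allI impI)
      fix y assume "\<bar>u - y\<bar> < min (u - (s - d)) (s + d - u)"
      then have "y \<in> ?I" by auto
      from min[OF this] show "?f u \<le> ?f y"
        by (simp add: dist_norm dot_square_norm power_mono)
    qed
    ultimately have "-2 * ((z - c u) \<bullet> vel u) = 0"
      using u' by (intro DERIV_local_min[where d = "min (u - (s - d)) (s + d - u)"]) auto
    then have orth: "(z - c u) \<bullet> vel u = 0" by simp
    have nz: "vel u \<noteq> 0" using regular[OF u01] .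
    define r where "r = Im ((z - c u) / vel u)"
    have "Re ((z - c u) / vel u) = 0"
      using orth by (simp add: Re_divide' inner_complex_def Re_divide)
    then have "(z - c u) / vel u = of_real r * \<i>"
      by (simp add: complex_eq_iff r_def)
    then have zeq: "z - c u = of_real r * \<i> * vel u"
      using nz by (simp add: divide_eq_eq)
    then have "z = side_point c u r" by (simp add: side_point_def algebra_simps)
    moreover have "\<bar>r\<bar> < \<delta>"
    proof -
      have "cmod (vel u - vel s) \<le> m / 4"
        using v[of u] u' d by (auto simp: m_def)
      then have "m / 2 \<le> cmod (vel u)"
        using norm_triangle_ineq3[of "vel u" "vel s"] m unfolding m_def by linarith
      then have "\<bar>r\<bar> * (m / 2) \<le> \<bar>r\<bar> * cmod (vel u)" by (rule mult_left_mono) simp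
      also have "\<dots> = dist z (c u)" by (simp add: dist_norm zeq norm_mult)
      also have "\<dots> < m * d / 4" using near by (simp add: \<eta>_def)
      finally have "m * \<bar>r\<bar> < m * (d / 2)" by (simp add: algebra_simps)
      then have "\<bar>r\<bar> < d / 2" using m by simp
      then show ?thesis using d by linarith
    qed
    moreover have "\<bar>u - s\<bar> < \<delta>" using u' d by auto
    ultimately show ?thesis by blast
  qed
  then show ?thesis using that \<eta> by blast
qed

lemma sides_le_nhds:
  assumes s: "s \<in> {0<..<1}"
  shows "left_side c s \<le> nhds (c s)" "right_side c s \<le> nhds (c s)"
    and "eventually (\<lambda>z. z \<notin> K) (left_side c s)" "eventually (\<lambda>z. z \<notin> K) (right_side c s)"
proof -
  have "(\<forall>\<^sub>F z in left_side c s. z \<in> ball (c s) \<eta>) \<and> (\<forall>\<^sub>F z in right_side c s. z \<in> ball (c s) \<eta>) \<and>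
     (\<forall>\<^sub>F z in left_side c s. z \<notin> K) \<and> (\<forall>\<^sub>F z in right_side c s. z \<notin> K)" if \<eta>: "\<eta> > 0" for \<eta>
  proof -
    obtain \<delta> where \<delta>: "\<delta> > 0"
      "\<And>u r. \<bar>u - s\<bar> < \<delta> \<Longrightarrow> \<bar>r\<bar> < \<delta> \<Longrightarrow> side_point c u r \<in> ball (c s) \<eta>"
      "\<And>u r. \<bar>u - s\<bar> < \<delta> \<Longrightarrow> \<bar>r\<bar> < \<delta> \<Longrightarrow> r \<noteq> 0 \<Longrightarrow> side_point c u r \<notin> K"
      by (rule side_points_avoid[OF s \<eta>]) (rule that)
    show ?thesis
      using \<delta>(2,3) by (intro conjI eventually_sides[OF \<delta>(1)]) auto
  qed
  note * = this
  have "G \<le> nhds (c s)" if "\<And>\<eta>. \<eta> > 0 \<Longrightarrow> \<forall>\<^sub>F z in G. z \<in> ball (c s) \<eta>" for G :: "complex filter"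
    unfolding le_filter_def eventually_nhds_metric
  proof (intro allI impI)
    fix Q assume "\<exists>d>0. \<forall>x. dist x (c s) < d \<longrightarrow> Q x"
    then obtain \<eta> where "\<eta> > 0" "\<And>x. x \<in> ball (c s) \<eta> \<Longrightarrow> Q x" by (auto simp: dist_commute)
    then show "\<forall>\<^sub>F z in G. Q z" using that[of \<eta>] by (auto elim: eventually_mono)
  qed
  then show "left_side c s \<le> nhds (c s)" "right_side c s \<le> nhds (c s)"
    using * by auto
  show "eventually (\<lambda>z. z \<notin> K) (left_side c s)" "eventually (\<lambda>z. z \<notin> K) (right_side c s)"
    using *[of 1] by auto
qed

definition extends_across :: "(complex \<Rightarrow> complex) \<Rightarrow> real \<Rightarrow> bool" where
  "extends_across R s \<longleftrightarrow>
     (\<exists>\<eta>>0. \<exists>f. f holomorphic_on ball (c s) \<eta> \<and> (\<forall>w\<in>ball (c s) \<eta> - K. R w = f w))"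

definition flips_across :: "(complex \<Rightarrow> complex) \<Rightarrow> real \<Rightarrow> bool" where
  "flips_across R s \<longleftrightarrow> (\<exists>w. w \<noteq> 0 \<and> (R \<longlongrightarrow> w) (left_side c s) \<and> (R \<longlongrightarrow> - w) (right_side c s))"

text \<open>A continuation across the cut would have equal limits on both sides.\<close>

lemma flips_imp_not_extends:
  assumes s: "s \<in> {0<..<1}" and "flips_across R s"
  shows "\<not> extends_across R s"
proof
  assume "extends_across R s"
  then obtain \<eta> f where \<eta>: "\<eta> > 0" and f: "f holomorphic_on ball (c s) \<eta>" "\<forall>w\<in>ball (c s) \<eta> - K. R w = f w"
    unfolding extends_across_def by blast
  have "isCont f (c s)"
    using f(1) \<eta> by (metis centre_in_ball continuous_on_interior holomorphic_on_imp_continuous_on interior_open open_ball)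
  then have lim: "(f \<longlongrightarrow> f (c s)) (nhds (c s))"
    by (simp add: continuous_at tendsto_at_iff_tendsto_nhds)
  have R: "(R \<longlongrightarrow> f (c s)) G" if G: "G \<le> nhds (c s)" "\<forall>\<^sub>F z in G. z \<notin> K" for G
  proof (rule Lim_transform_eventually)
    show "(f \<longlongrightarrow> f (c s)) G" using lim G(1) by (rule tendsto_mono[rotated])
    have "\<forall>\<^sub>F z in nhds (c s). z \<in> ball (c s) \<eta>"
      using \<eta> by (intro eventually_nhds_in_open) auto
    then have "\<forall>\<^sub>F z in G. z \<in> ball (c s) \<eta>" using G(1) by (rule filter_leD[rotated])
    with G(2) show "\<forall>\<^sub>F z in G. f z = R z"
      by eventually_elim (use f(2) in auto)
  qed
  obtain w where "w \<noteq> 0" and l: "(R \<longlongrightarrow> w) (left_side c s)" and r: "(R \<longlongrightarrow> - w) (right_side c s)"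
    using assms(2) by (auto simp: flips_across_def)
  have "w = f (c s)"
    using tendsto_unique[OF _ l R] sides_le_nhds[OF s] by simp
  moreover have "- w = f (c s)"
    using tendsto_unique[OF _ r R] sides_le_nhds[OF s] by simp
  ultimately show False using \<open>w \<noteq> 0\<close> by (simp add: eq_neg_iff_add_eq_0)
qed

text \<open>The rectangle \<open>{s - \<delta><..<s + \<delta>} \<times> {0<..<\<delta>}\<close> and its reflection are connected, so on each side \<open>R\<close> is a
  constant sign times a fixed analytic root \<open>p\<close> of \<open>P\<close>. If the signs differ, \<open>R\<close> flips; if they agree, the
  two sides together fill a neighbourhood of \<open>c s\<close> up to the arc itself, and \<open>\<plusminus> p\<close> continues \<open>R\<close>.\<close>

lemma extends_or_flips_locally:
  assumes s: "s \<in> {0<..<1}" and R: "continuous_on (- K) R"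
    and sq: "\<And>z. z \<notin> K \<Longrightarrow> (R z)\<^sup>2 = P z"
    and P: "P holomorphic_on UNIV" "P (c s) \<noteq> 0"
  shows "\<exists>\<delta>>0. {s - \<delta><..<s + \<delta>} \<subseteq> {0<..<1} \<and>
    ((\<forall>u\<in>{s - \<delta><..<s + \<delta>}. extends_across R u) \<or> (\<forall>u\<in>{s - \<delta><..<s + \<delta>}. flips_across R u))"
proof -
  have "isCont P (c s)"
    using holomorphic_on_imp_continuous_on[OF P(1)] by (simp add: continuous_on_eq_continuous_at)
  then obtain \<eta> where \<eta>: "\<eta> > 0" and Pnz: "\<And>z. z \<in> ball (c s) \<eta> \<Longrightarrow> P z \<noteq> 0"
    using continuous_at_avoid[of "c s" P 0] P(2) by (auto simp: dist_commute)
  obtain p where p: "p holomorphic_on ball (c s) \<eta>" and p2: "\<And>z. z \<in> ball (c s) \<eta> \<Longrightarrow> P z = (p z)\<^sup>2"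
  proof (rule contractible_imp_holomorphic_sqrt)
    show "P holomorphic_on ball (c s) \<eta>" using P(1) by (rule holomorphic_on_subset) simp
    show "contractible (ball (c s) \<eta>)" by (simp add: convex_imp_contractible)
  qed (use Pnz in auto)
  have pnz: "p z \<noteq> 0" if "z \<in> ball (c s) \<eta>" for z
    using Pnz[OF that] p2[OF that] by auto
  have pcont: "continuous_on (ball (c s) \<eta>) p"
    using p by (rule holomorphic_on_imp_continuous_on)
  obtain \<delta> where \<delta>: "\<delta> > 0" "{s - \<delta><..<s + \<delta>} \<subseteq> {0<..<1}"
    and inball: "\<And>u r. \<bar>u - s\<bar> < \<delta> \<Longrightarrow> \<bar>r\<bar> < \<delta> \<Longrightarrow> side_point c u r \<in> ball (c s) \<eta>"
    and offK: "\<And>u r. \<bar>u - s\<bar> < \<delta> \<Longrightarrow> \<bar>r\<bar> < \<delta> \<Longrightarrow> r \<noteq> 0 \<Longrightarrow> side_point c u r \<notin> K"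
    by (rule side_points_avoid[OF s \<eta>]) (rule that)
  \<comment> \<open>a one-sided collar is the image of an open rectangle, hence connected\<close>
  have sign: "\<exists>e\<in>{1, -1}. \<forall>u r. \<bar>u - s\<bar> < \<delta> \<longrightarrow> r \<in> J \<longrightarrow>
      R (side_point c u r) = e * p (side_point c u r)"
    if J: "connected J" "J \<subseteq> {-\<delta><..<\<delta>} - {0}" for J
  proof -
    let ?X = "(\<lambda>(s, r). side_point c s r) ` ({s - \<delta><..<s + \<delta>} \<times> J)"
    have "connected ?X"
      using J(1) \<delta>(2)
      by (intro connected_continuous_image continuous_on_subset[OF side_point_continuous] connected_Times) auto
    moreover have sub: "?X \<subseteq> ball (c s) \<eta> - K"
    proof
      fix z assume "z \<in> ?X"
      then obtain u r where ur: "u \<in> {s - \<delta><..<s + \<delta>}" "r \<in> J" "z = side_point c u r"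
        by auto
      moreover have "\<bar>u - s\<bar> < \<delta>" using ur(1) by (auto simp: abs_less_iff)
      moreover have "\<bar>r\<bar> < \<delta>" "r \<noteq> 0" using subsetD[OF J(2) ur(2)] by (auto simp: abs_less_iff)
      ultimately show "z \<in> ball (c s) \<eta> - K" using inball offK by blast
    qed
    moreover have "continuous_on ?X R" "continuous_on ?X p"
      using sub by (auto intro: continuous_on_subset[OF R] continuous_on_subset[OF pcont])
    moreover have "(R z)\<^sup>2 = (p z)\<^sup>2" "p z \<noteq> 0" if "z \<in> ?X" for z
      using sub that sq[of z] p2[of z] pnz[of z] by (simp_all add: subset_iff)
    ultimately obtain e where "e \<in> {1, -1}" "\<And>z. z \<in> ?X \<Longrightarrow> R z = e * p z"
      using sqrt_sign_constant[of ?X R p] by metis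
    moreover have "side_point c u r \<in> ?X" if "\<bar>u - s\<bar> < \<delta>" "r \<in> J" for u r
      using that by (intro image_eqI[of _ _ "(u, r)"]) (auto simp: abs_less_iff)
    ultimately show ?thesis by blast
  qed
  obtain e1 where e1: "e1 \<in> {1, -1}" "\<And>u r. \<bar>u - s\<bar> < \<delta> \<Longrightarrow> r \<in> {0<..<\<delta>} \<Longrightarrow>
      R (side_point c u r) = e1 * p (side_point c u r)"
    using sign[of "{0<..<\<delta>}"] \<delta>(1) by (force simp: subset_iff)
  obtain e2 where e2: "e2 \<in> {1, -1}" "\<And>u r. \<bar>u - s\<bar> < \<delta> \<Longrightarrow> r \<in> {-\<delta><..<0} \<Longrightarrow>
      R (side_point c u r) = e2 * p (side_point c u r)"
    using sign[of "{-\<delta><..<0}"] \<delta>(1) by (force simp: subset_iff)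
  have c_ball: "c u \<in> ball (c s) \<eta>" if "\<bar>u - s\<bar> < \<delta>" for u
    using inball[OF that, of 0] \<delta>(1) by (simp add: side_point_def)
  show ?thesis
  proof (cases "e1 = e2")
    case False
    then have e: "e2 = - e1" using e1(1) e2(1) by auto
    have "flips_across R u" if "u \<in> {s - \<delta><..<s + \<delta>}" for u
    proof -
      have us: "\<bar>u - s\<bar> < \<delta>" using that by auto
      have u01: "u \<in> {0<..<1}" using that \<delta> by blast
      have "isCont p (c u)"
        using pcont c_ball[OF us] by (metis continuous_on_interior interior_open open_ball)
      then have lim: "(p \<longlongrightarrow> p (c u)) (nhds (c u))"
        by (simp add: continuous_at tendsto_at_iff_tendsto_nhds)
      define d where "d = \<delta> - \<bar>u - s\<bar>"
      have d: "d > 0" using us by (simp add: d_def)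
      have "(R \<longlongrightarrow> e1 * p (c u)) (left_side c u)"
      proof (rule Lim_transform_eventually)
        show "((\<lambda>z. e1 * p z) \<longlongrightarrow> e1 * p (c u)) (left_side c u)"
          using lim sides_le_nhds[OF u01] by (intro tendsto_intros) (rule tendsto_mono)
        show "\<forall>\<^sub>F z in left_side c u. e1 * p z = R z"
          by (rule eventually_sides[OF d]) (use e1(2) in \<open>auto simp: d_def\<close>)
      qed
      moreover have "(R \<longlongrightarrow> e2 * p (c u)) (right_side c u)"
      proof (rule Lim_transform_eventually)
        show "((\<lambda>z. e2 * p z) \<longlongrightarrow> e2 * p (c u)) (right_side c u)"
          using lim sides_le_nhds[OF u01] by (intro tendsto_intros) (rule tendsto_mono)
        show "\<forall>\<^sub>F z in right_side c u. e2 * p z = R z"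
          by (rule eventually_sides[OF d]) (use e2(2) in \<open>auto simp: d_def\<close>)
      qed
      ultimately show ?thesis
        unfolding flips_across_def using e e1(1) pnz[OF c_ball[OF us]]
        by (intro exI[of _ "e1 * p (c u)"]) auto
    qed
    then show ?thesis using \<delta> by blast
  next
    case True
    obtain \<eta>1 where \<eta>1: "\<eta>1 > 0"
      "\<And>z. z \<in> ball (c s) \<eta>1 \<Longrightarrow> \<exists>u r. \<bar>u - s\<bar> < \<delta> \<and> \<bar>r\<bar> < \<delta> \<and> z = side_point c u r"
      by (rule side_points_cover[OF s \<delta>(1)]) (rule that)
    define V where "V = ball (c s) (min \<eta> \<eta>1)"
    have V: "R z = e1 * p z" if z: "z \<in> V - K" for z
    proof -
      obtain u r where u: "\<bar>u - s\<bar> < \<delta>" "\<bar>r\<bar> < \<delta>" "z = side_point c u r"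
        using \<eta>1(2)[of z] z unfolding V_def by auto
      have "u \<in> {0<..<1}" using u(1) \<delta>(2) by (auto simp: subset_iff abs_less_iff)
      then have "c u \<in> K" using in_K by auto
      then have "r \<noteq> 0" using z u by (auto simp: side_point_def)
      then show ?thesis
        using e1(2)[OF u(1), of r] e2(2)[OF u(1), of r] u True by (cases "r > 0") auto
    qed
    obtain \<delta>2 where \<delta>2: "\<delta>2 > 0" "{s - \<delta>2<..<s + \<delta>2} \<subseteq> {0<..<1}"
      "\<And>u r. \<bar>u - s\<bar> < \<delta>2 \<Longrightarrow> \<bar>r\<bar> < \<delta>2 \<Longrightarrow> side_point c u r \<in> V"
      by (rule side_points_avoid[OF s, of "min \<eta> \<eta>1", folded V_def]) (use \<eta> \<eta>1(1) in simp, rule that)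
    have "extends_across R u" if "u \<in> {s - \<delta>2<..<s + \<delta>2}" for u
    proof -
      have "c u \<in> V" using \<delta>2(3)[of u 0] that \<delta>2(1) by (auto simp: side_point_def)
      then obtain \<eta>3 where \<eta>3: "\<eta>3 > 0" "ball (c u) \<eta>3 \<subseteq> V"
        unfolding V_def by (meson open_ball openE)
      have "(\<lambda>z. e1 * p z) holomorphic_on ball (c u) \<eta>3"
        using \<eta>3(2) by (intro holomorphic_intros holomorphic_on_subset[OF p]) (auto simp: V_def)
      then show ?thesis
        unfolding extends_across_def using \<eta>3 V by (intro exI[of _ \<eta>3] conjI exI[of _ "\<lambda>z. e1 * p z"]) auto
    qed
    then show ?thesis using \<delta>2(1,2) by blast
  qed
qed

text \<open>By \<open>extends_or_flips_locally\<close>, the set of parameters where \<open>R\<close> extends across the arc is open and closed in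
  \<open>(0,1)\<close>. If it were all of \<open>(0,1)\<close>, the continuations would glue to a holomorphic root of \<open>P\<close> in a punctured
  disc around the initial point \<open>c 0\<close>, where \<open>P\<close> has a simple zero. Only the initial point of the arc is
  inspected, which is why bounded and unbounded arcs are treated alike.\<close>

theorem sqrt_flips_across_slit:
  assumes R: "R holomorphic_on - K" and sq: "\<And>z. z \<notin> K \<Longrightarrow> (R z)\<^sup>2 = P z"
    and P: "P holomorphic_on UNIV" "\<And>s. s \<in> {0<..<1} \<Longrightarrow> P (c s) \<noteq> 0"
    and tip: "P (c 0) = 0" "(P has_field_derivative d) (at (c 0))" "d \<noteq> 0"
    and s: "s \<in> {0<..<1}"
  shows "flips_across R s"
proof (rule ccontr)
  assume no_flip: "\<not> flips_across R s"
  have Rc: "continuous_on (- K) R" using R by (rule holomorphic_on_imp_continuous_on)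
  have alt: "\<exists>\<delta>>0. {u - \<delta><..<u + \<delta>} \<subseteq> {0<..<1} \<and>
    ((\<forall>v\<in>{u - \<delta><..<u + \<delta>}. extends_across R v) \<or> (\<forall>v\<in>{u - \<delta><..<u + \<delta>}. flips_across R v))"
    if "u \<in> {0<..<1}" for u
    by (rule extends_or_flips_locally[OF that Rc sq P(1) P(2)[OF that]])
  have "extends_across R u \<longleftrightarrow> extends_across R s" if u: "u \<in> {0<..<1}" for u
  proof (rule connected_local_const[of "{0<..<1::real}" u s])
    show "\<forall>a\<in>{0<..<1}. \<forall>\<^sub>F b in at a within {0<..<1}. extends_across R a = extends_across R b"
    proof
      fix a :: real assume a: "a \<in> {0<..<1}"
      obtain \<delta> where \<delta>: "\<delta> > 0" "{a - \<delta><..<a + \<delta>} \<subseteq> {0<..<1}" and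
        or: "(\<forall>u\<in>{a - \<delta><..<a + \<delta>}. extends_across R u) \<or> (\<forall>u\<in>{a - \<delta><..<a + \<delta>}. flips_across R u)"
        using alt[OF a] by (elim exE conjE)
      have "extends_across R a = extends_across R b" if b: "b \<in> {a - \<delta><..<a + \<delta>}" for b
      proof -
        have a': "a \<in> {a - \<delta><..<a + \<delta>}" using \<delta>(1) by simp
        have "b \<in> {0<..<1}" using b \<delta>(2) by blast
        then show ?thesis
          using or a' b flips_imp_not_extends[OF a] flips_imp_not_extends[of b] by blast
      qed
      moreover have "\<forall>\<^sub>F b in at a within {0<..<1}. b \<in> {a - \<delta><..<a + \<delta>}"
        using \<delta>(1) by (intro topological_tendstoD[OF tendsto_ident_at]) auto
      ultimately show "\<forall>\<^sub>F b in at a within {0<..<1}. extends_across R a = extends_across R b"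
        by (auto elim: eventually_mono)
    qed
  qed (use u s in auto)
  moreover have "extends_across R s"
  proof -
    obtain \<delta> where "\<delta> > 0" "(\<forall>u\<in>{s - \<delta><..<s + \<delta>}. extends_across R u) \<or> (\<forall>u\<in>{s - \<delta><..<s + \<delta>}. flips_across R u)"
      using alt[OF s] by (elim exE conjE)
    then show ?thesis using no_flip by force
  qed
  ultimately have ext: "extends_across R u" if "u \<in> {0<..<1}" for u using that by blast
  obtain \<eta> where \<eta>: "\<eta> > 0" "K \<inter> ball (c 0) \<eta> \<subseteq> c ` ({0..<1} \<inter> {0 - 1<..<0 + 1})"
    using isolated[of 0 1] by auto
  let ?B = "ball (c 0) \<eta> - {c 0}"
  have BK: "\<exists>u\<in>{0<..<1}. z = c u" if "z \<in> ?B" "z \<in> K" for z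
  proof -
    obtain u where "u \<in> {0..<1}" "z = c u" using \<eta>(2) \<open>z \<in> ?B\<close> \<open>z \<in> K\<close> by auto
    moreover have "u \<noteq> 0" using calculation \<open>z \<in> ?B\<close> by auto
    ultimately show ?thesis by force
  qed
  have dense: "?B \<subseteq> closure (- K)"
  proof
    fix z assume z: "z \<in> ?B"
    show "z \<in> closure (- K)"
    proof (cases "z \<in> K")
      case True
      then obtain u where u: "u \<in> {0<..<1}" "z = c u" using BK z by blast
      show ?thesis
        unfolding closure_approachable
      proof (intro allI impI)
        fix e :: real assume "e > 0"
        then have "\<forall>\<^sub>F w in nhds (c u). w \<in> ball (c u) e"
          by (intro eventually_nhds_in_open) auto
        then have "\<forall>\<^sub>F w in left_side c u. w \<in> ball (c u) e"
          using sides_le_nhds(1)[OF u(1)] by (rule filter_leD[rotated])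
        then have "\<forall>\<^sub>F w in left_side c u. w \<in> ball (c u) e \<and> w \<notin> K"
          using sides_le_nhds(3)[OF u(1)] by (rule eventually_conj)
        then obtain w where "w \<in> ball (c u) e" "w \<notin> K"
          using eventually_happens'[OF side_ne_bot(1)] by blast
        then show "\<exists>y\<in>- K. dist y z < e" using u by (auto simp: dist_commute)
      qed
    next
      case False
      then show ?thesis using closure_subset by blast
    qed
  qed
  obtain F where F: "F holomorphic_on ?B" "\<And>z. z \<in> ?B - K \<Longrightarrow> F z = R z"
  proof (rule holomorphic_glue_across[OF _ closed_K dense])
    show "\<exists>\<eta>>0. \<exists>f. f holomorphic_on ball z \<eta> \<and> (\<forall>w\<in>ball z \<eta> - K. R w = f w)" if z: "z \<in> ?B" for z
    proof (cases "z \<in> K")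
      case True
      then show ?thesis using BK[OF z] ext unfolding extends_across_def by blast
    next
      case False
      then obtain \<eta>' where "\<eta>' > 0" "ball z \<eta>' \<subseteq> - K"
        using closed_K by (metis ComplI openE open_Compl)
      then have "R holomorphic_on ball z \<eta>'" using R by (metis holomorphic_on_subset)
      with \<open>\<eta>' > 0\<close> show ?thesis by blast
    qed
  qed auto
  have F2: "(F z)\<^sup>2 = P z" if z: "z \<in> ?B" for z
  proof -
    have "continuous_on ?B (\<lambda>z. (F z)\<^sup>2 - P z)"
      using F(1) P(1) by (intro continuous_intros holomorphic_on_imp_continuous_on)
        (auto intro: holomorphic_on_subset)
    have open_B: "open ?B" by auto
    have "?B \<subseteq> closure (?B - K)"
      using open_Int_closure_subset[OF open_B, of "- K"] dense by (auto simp: Diff_eq)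
    show ?thesis
    proof (rule ccontr)
      assume ne: "(F z)\<^sup>2 \<noteq> P z"
      have "isCont (\<lambda>z. (F z)\<^sup>2 - P z) z"
        using \<open>continuous_on ?B (\<lambda>z. (F z)\<^sup>2 - P z)\<close> open_B z
        by (simp add: continuous_on_eq_continuous_at)
      then obtain e where e: "e > 0" "\<forall>y. dist z y < e \<longrightarrow> (F y)\<^sup>2 - P y \<noteq> 0"
        using continuous_at_avoid[of z "\<lambda>z. (F z)\<^sup>2 - P z" 0] ne by auto
      obtain y where "y \<in> ?B - K" "dist y z < e"
        using \<open>?B \<subseteq> closure (?B - K)\<close> z e(1) by (meson closure_approachable in_mono)
      then show False using e(2) F(2)[of y] sq[of y] by (auto simp: dist_commute)
    qed
  qed
  show False
    using no_holomorphic_sqrt_at_simple_zero[OF \<eta>(1) F(1) F2 tip(2,1,3)] by blast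
qed

end

section \<open>Functions with a limit at infinity\<close>

text \<open>In the coordinate \<open>1/z\<close> the limit makes the singularity at the origin removable, and \<open>f\<close> becomes
  differentiable there.\<close>

lemma limit_at_infinity_rate:
  fixes f :: "complex \<Rightarrow> complex"
  assumes f: "f analytic_on {z. 1 < cmod z}" and lim: "(f \<longlongrightarrow> l) at_infinity"
  shows "(\<lambda>z. f z - l) \<in> O[at_infinity](\<lambda>z. 1 / z)"
proof -
  let ?B = "ball (0::complex) 1"
  have "f \<circ> inverse holomorphic_on ?B - {0}"
  proof (rule holomorphic_on_compose_gen[where t = "{z. 1 < cmod z}"])
    show "inverse holomorphic_on ?B - {0}" by (intro holomorphic_intros) auto
    show "f holomorphic_on {z. 1 < cmod z}" using f by (rule analytic_imp_holomorphic)
    show "inverse ` (?B - {0}) \<subseteq> {z. 1 < cmod z}"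
      by (auto simp: norm_inverse one_less_inverse)
  qed
  moreover have h0: "((f \<circ> inverse) \<longlongrightarrow> l) (at 0)"
    unfolding o_def by (rule filterlim_compose[OF lim filterlim_inverse_at_infinity])
  have "((\<lambda>w. (w - 0) * (f \<circ> inverse) w) \<longlongrightarrow> (0 - 0) * l) (at 0)"
    by (intro tendsto_intros h0)
  then have "((\<lambda>w. (w - 0) * (f \<circ> inverse) w) \<longlongrightarrow> 0) (at 0)" by simp
  ultimately obtain G where G: "G holomorphic_on ?B" "\<forall>w\<in>?B - {0}. G w = (f \<circ> inverse) w"
    using holomorphic_on_extend_lim[of "f \<circ> inverse" ?B 0] by (auto simp: interior_open)
  have "G field_differentiable at 0"
    using G(1) by (simp add: holomorphic_on_imp_differentiable_at)
  then obtain d where d: "(G has_field_derivative d) (at 0)"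
    by (auto simp: field_differentiable_def)
  have ev: "\<forall>\<^sub>F w in at 0. G w = (f \<circ> inverse) w"
    using eventually_at_in_open[of ?B 0] G(2) by (auto elim!: eventually_mono)
  have "(G \<longlongrightarrow> l) (at 0)"
    by (rule Lim_transform_eventually[OF h0]) (use ev in \<open>auto elim: eventually_mono\<close>)
  then have "G 0 = l"
    using DERIV_isCont[OF d] by (simp add: isCont_def LIM_unique)
  have "((\<lambda>w. (G w - l) / w) \<longlongrightarrow> d) (at 0)"
    using d \<open>G 0 = l\<close> by (simp add: has_field_derivative_iff)
  then have "((\<lambda>w. ((f \<circ> inverse) w - l) / w) \<longlongrightarrow> d) (at 0)"
    by (rule Lim_transform_eventually) (use ev in \<open>auto elim: eventually_mono\<close>)
  moreover have "filterlim inverse (at (0::complex)) at_infinity"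
    unfolding filterlim_at
    using tendsto_inverse_0 eventually_not_equal_at_infinity[of 0] by (auto elim: eventually_mono)
  ultimately have "((\<lambda>z. ((f \<circ> inverse) (inverse z) - l) / inverse z) \<longlongrightarrow> d) at_infinity"
    by (rule filterlim_compose)
  then have "((\<lambda>z. (f z - l) / (1 / z)) \<longlongrightarrow> d) at_infinity"
    by (simp add: o_def inverse_eq_divide)
  then show ?thesis
    by (rule bigoI_tendsto) (use eventually_not_equal_at_infinity[of "0::complex"] in \<open>auto elim: eventually_mono\<close>)
qed

section \<open>The cuts as slits\<close>

text \<open>Only a compact initial piece of the arc meets a given bounded set.\<close>

lemma closed_image_arc_to_infinity:
  fixes c :: "real \<Rightarrow> complex"
  assumes cont: "continuous_on {0..<1} c" and lim: "filterlim c at_infinity (at_left 1)" and "closed T"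
  shows "closed (c ` ({0..<1} \<inter> T))"
proof -
  have "\<exists>e>0. ball z e \<subseteq> - c ` ({0..<1} \<inter> T)" if z: "z \<in> - c ` ({0..<1} \<inter> T)" for z
  proof -
    have "\<forall>\<^sub>F s in at_left 1. cmod z + 1 \<le> cmod (c s)"
      using filterlim_at_infinity_imp_norm_at_top[OF lim] unfolding filterlim_at_top by blast
    then obtain b where b: "b < 1" "\<And>s. b < s \<Longrightarrow> s < 1 \<Longrightarrow> cmod z + 1 \<le> cmod (c s)"
      by (auto simp: eventually_at_left_field)
    define b' where "b' = max 0 b"
    have b': "b' < 1" "0 \<le> b'" using b by (auto simp: b'_def)
    have "compact ({0..b'} \<inter> T)" using \<open>closed T\<close> by (simp add: compact_Int_closed)
    then have "compact (c ` ({0..b'} \<inter> T))"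
      using b' by (intro compact_continuous_image continuous_on_subset[OF cont]) auto
    then have "open (- c ` ({0..b'} \<inter> T))" by (simp add: compact_imp_closed open_Compl)
    moreover have "z \<in> - c ` ({0..b'} \<inter> T)" using z b' by auto
    ultimately obtain e where e: "e > 0" "ball z e \<subseteq> - c ` ({0..b'} \<inter> T)"
      by (meson openE)
    have "w \<noteq> c s" if w: "w \<in> ball z (min e 1)" and s: "s \<in> {0..<1} \<inter> T" for w s
    proof (cases "s \<le> b'")
      case True
      then show ?thesis using e(2) w s by auto
    next
      case False
      then have "cmod z + 1 \<le> cmod (c s)" using b(2)[of s] s by (simp add: b'_def)
      moreover have "cmod w < cmod z + 1"
        using w norm_triangle_ineq2[of w z] by (simp add: dist_norm norm_minus_commute)
      ultimately show ?thesis by auto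
    qed
    then have "ball z (min e 1) \<subseteq> - c ` ({0..<1} \<inter> T)" by blast
    then show ?thesis using e(1) by (intro exI[of _ "min e 1"]) simp
  qed
  then have "open (- c ` ({0..<1} \<inter> T))" by (simp add: open_contains_ball)
  then show ?thesis by (simp add: closed_def)
qed

lemma cut_system_regular:
  assumes cs: "cut_system g a \<gamma>" and j: "j \<in> {1..g + 1}"
  defines "I \<equiv> (if j \<le> g then {0..1} else {0..<1::real})"
  shows "inj_on (\<gamma> j) I" and "continuous_on I (\<gamma> j)"
    and "closed T \<Longrightarrow> closed (\<gamma> j ` (I \<inter> T))"
proof -
  show inj: "inj_on (\<gamma> j) I" and cont: "continuous_on I (\<gamma> j)"
    using cs j by (cases "j \<le> g"; auto simp: cut_system_def I_def arc_def path_def le_Suc_eq)+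
  assume "closed T"
  show "closed (\<gamma> j ` (I \<inter> T))"
  proof (cases "j \<le> g")
    case True
    then have "compact (I \<inter> T)" using \<open>closed T\<close> by (simp add: I_def compact_Int_closed)
    then have "compact (\<gamma> j ` (I \<inter> T))"
      by (intro compact_continuous_image continuous_on_subset[OF cont]) auto
    then show ?thesis by (rule compact_imp_closed)
  next
    case False
    then have "j = g + 1" using j by simp
    then show ?thesis
      using cs \<open>closed T\<close> closed_image_arc_to_infinity[of "\<gamma> j" T]
      by (simp add: I_def cut_system_def)
  qed
qed

lemma closed_cuts:
  assumes "cut_system g a \<gamma>"
  shows "closed (cuts g \<gamma>)"
  unfolding cuts_def cut_def
  using cut_system_regular(3)[OF assms, of _ UNIV] by (intro closed_UN) auto

lemma cut_system_slit:
  assumes cs: "cut_system g a \<gamma>" and j: "j \<in> {1..g + 1}"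
  shows "regular_slit (cuts g \<gamma>) (\<gamma> j)"
proof
  let ?I = "\<lambda>k. if k \<le> g then {0..1} else {0..<1::real}"
  have sub: "{0..<1} \<subseteq> ?I j" by auto
  show "closed (cuts g \<gamma>)" using cs by (rule closed_cuts)
  show "\<gamma> j ` {0..<1} \<subseteq> cuts g \<gamma>" using j sub unfolding cuts_def cut_def by blast
  show "continuous_on {0..<1} (\<gamma> j)" "inj_on (\<gamma> j) {0..<1}"
    using cut_system_regular(1,2)[OF cs j] sub by (auto intro: continuous_on_subset inj_on_subset)
  show "\<gamma> j C1_differentiable_on {0<..<1}" "\<And>s. s \<in> {0<..<1} \<Longrightarrow> vector_derivative (\<gamma> j) (at s) \<noteq> 0"
    using cs j by (auto simp: cut_system_def)
  fix s \<delta> :: real assume s: "s \<in> {0..<1}" and "\<delta> > 0"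
  define d where "d = min \<delta> (1 - s)"
  have d: "d > 0" "d \<le> \<delta>" "d \<le> 1 - s" using s \<open>\<delta> > 0\<close> by (auto simp: d_def)
  let ?T = "{..s - d} \<union> {s + d..}"
  let ?rest = "(\<Union>k\<in>{1..g + 1} - {j}. cut g \<gamma> k) \<union> \<gamma> j ` (?I j \<inter> ?T)"
  have "closed (cut g \<gamma> k)" if "k \<in> {1..g + 1}" for k
    using cut_system_regular(3)[OF cs that, of UNIV] by (simp add: cut_def)
  then have "closed ?rest"
    by (intro closed_Un closed_UN cut_system_regular(3)[OF cs j]) auto
  moreover have "\<gamma> j s \<in> cut g \<gamma> j" using s sub unfolding cut_def by blast
  then have "\<gamma> j s \<notin> (\<Union>k\<in>{1..g + 1} - {j}. cut g \<gamma> k)"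
    using cs j unfolding cut_system_def disjoint_family_on_def by blast
  moreover have "\<gamma> j s \<notin> \<gamma> j ` (?I j \<inter> ?T)"
  proof
    assume "\<gamma> j s \<in> \<gamma> j ` (?I j \<inter> ?T)"
    then obtain u where u: "u \<in> ?I j" "u \<in> ?T" "\<gamma> j s = \<gamma> j u" by blast
    have "s \<in> ?I j" using s sub by blast
    with u have "s = u" by (intro inj_onD[OF cut_system_regular(1)[OF cs j]])
    then show False using u d(1) by simp
  qed
  ultimately obtain \<eta> where \<eta>: "\<eta> > 0" "ball (\<gamma> j s) \<eta> \<subseteq> - ?rest"
    by (metis ComplI UnE openE open_Compl)
  have "cuts g \<gamma> \<inter> ball (\<gamma> j s) \<eta> \<subseteq> \<gamma> j ` ({0..<1} \<inter> {s - \<delta><..<s + \<delta>})"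
  proof
    fix z assume z: "z \<in> cuts g \<gamma> \<inter> ball (\<gamma> j s) \<eta>"
    then have nr: "z \<notin> ?rest" using \<eta>(2) by blast
    moreover have "z \<in> cuts g \<gamma>" using z by blast
    ultimately have "z \<in> \<gamma> j ` ?I j" unfolding cuts_def cut_def by blast
    then obtain u where u: "u \<in> ?I j" "z = \<gamma> j u" by blast
    then have "u \<notin> ?T" using nr by blast
    moreover have "0 \<le> u" using u(1) by (auto split: if_splits)
    ultimately show "z \<in> \<gamma> j ` ({0..<1} \<inter> {s - \<delta><..<s + \<delta>})"
      using d u(2) by auto
  qed
  then show "\<exists>\<eta>>0. cuts g \<gamma> \<inter> ball (\<gamma> j s) \<eta> \<subseteq> \<gamma> j ` ({0..<1} \<inter> {s - \<delta><..<s + \<delta>})"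
    using \<eta>(1) by blast
qed

text \<open>For odd \<open>k\<close> the point \<open>a k\<close> is an initial point, for even \<open>k\<close> a final point.\<close>

lemma branch_point_is_endpoint:
  assumes cs: "cut_system g a \<gamma>" and k: "k \<in> {1..2 * g + 1}"
  obtains m u where "m \<in> {1..g + 1}" "u \<in> (if m \<le> g then {0..1} else {0..<1::real})"
    "u = 0 \<or> u = 1" "\<gamma> m u = a k"
proof (cases "odd k")
  case True
  then obtain i where i: "k = 2 * i + 1" by (elim oddE)
  have "\<gamma> (i + 1) 0 = a k"
  proof (cases "i < g")
    case True
    then have "pathstart (\<gamma> (i + 1)) = a (2 * (i + 1) - 1)" using cs by (simp add: cut_system_def)
    then show ?thesis using i by (simp add: pathstart_def)
  next
    case False
    then have "i = g" using k i by simp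
    then show ?thesis using cs i by (simp add: cut_system_def)
  qed
  then show ?thesis using that[of "i + 1" 0] k i by auto
next
  case False
  then obtain i where i: "k = 2 * i" by (auto elim: evenE)
  then have "i \<in> {1..g}" using k by auto
  then have "pathfinish (\<gamma> i) = a (2 * i)" using cs by (simp add: cut_system_def)
  then show ?thesis using that[of i 1] \<open>i \<in> {1..g}\<close> i by (auto simp: pathfinish_def)
qed

lemma branch_point_in_cuts:
  assumes "cut_system g a \<gamma>" "k \<in> {1..2 * g + 1}"
  shows "a k \<in> cuts g \<gamma>"
proof -
  obtain m u where m: "m \<in> {1..g + 1}" "u \<in> (if m \<le> g then {0..1} else {0..<1::real})"
    "u = 0 \<or> u = 1" "\<gamma> m u = a k"
    by (rule branch_point_is_endpoint[OF assms])
  have "a k \<in> cut g \<gamma> m" unfolding cut_def m(4)[symmetric] using m(2) by (rule imageI)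
  then show ?thesis unfolding cuts_def using m(1) by blast
qed

lemma branch_point_off_open_cut:
  assumes cs: "cut_system g a \<gamma>" and k: "k \<in> {1..2 * g + 1}" and j: "j \<in> {1..g + 1}" and s: "s \<in> {0<..<1}"
  shows "\<gamma> j s \<noteq> a k"
proof
  assume eq: "\<gamma> j s = a k"
  obtain m u where m: "m \<in> {1..g + 1}" "u \<in> (if m \<le> g then {0..1} else {0..<1::real})"
    "u = 0 \<or> u = 1" "\<gamma> m u = a k"
    by (rule branch_point_is_endpoint[OF cs k])
  have sI: "s \<in> (if j \<le> g then {0..1} else {0..<1})" using s by auto
  have "a k \<in> cut g \<gamma> m" unfolding cut_def m(4)[symmetric] using m(2) by (rule imageI)
  moreover have "a k \<in> cut g \<gamma> j" unfolding cut_def eq[symmetric] using sI by (rule imageI)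
  ultimately have "m = j"
    using cs m(1) j unfolding cut_system_def disjoint_family_on_def by blast
  have "u = s"
    by (rule inj_onD[OF cut_system_regular(1)[OF cs j]]) (use m eq sI \<open>m = j\<close> in simp_all)
  then show False using m(3) s by auto
qed

section \<open>The matrix function S\<close>

text \<open>The data of the factorization problem: \<open>R\<close>, \<open>q\<close> and \<open>sq\<close> are the branches of \<open>P\<^sup>1\<^sup>/\<^sup>2\<close>, \<open>(P/z)\<^sup>1\<^sup>/\<^sup>2\<close> and
  \<open>z\<^sup>1\<^sup>/\<^sup>2\<close>, and \<open>Tm\<close>, \<open>Tp\<close> are the two factors.\<close>

locale spectral_problem =
  fixes g :: nat and a t :: "nat \<Rightarrow> complex" and \<gamma> :: "nat \<Rightarrow> real \<Rightarrow> complex"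
    and q sq R :: "complex \<Rightarrow> complex" and Tm Tp :: "complex \<Rightarrow> cmat2"
  assumes a_mono: "strict_mono_on {1..2 * g + 1} (\<lambda>j. cmod (a j))"
    and a_less_1: "cmod (a (2 * g + 1)) < 1"
    and cut_sys: "cut_system g a \<gamma>"
    and R_branch: "sqrt_branch (- cuts g \<gamma>) (Ppoly g a) R"
    and q_branch: "sqrt_branch {z. 1 \<le> cmod z} (\<lambda>z. Ppoly g a z / z) q"
    and sq_branch: "sqrt_branch ({z. 1 \<le> cmod z} - cut g \<gamma> (g + 1)) (\<lambda>z. z) sq"
    and R_outside: "\<And>z. 1 \<le> cmod z \<Longrightarrow> z \<notin> cuts g \<gamma> \<Longrightarrow> R z = sq z * q z"
    and factorized: "factorization (\<lambda>z. mexp (xi t z) ** Wmat g a q z) Tm Tp"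
begin

abbreviation "P \<equiv> Ppoly g a"
abbreviation "Q \<equiv> Qpoly g a"
abbreviation "K \<equiv> cuts g \<gamma>"
abbreviation "S \<equiv> Sfun g a t sq R Tm Tp"

lemma R_holo: "R holomorphic_on - K" and R_sq: "z \<notin> K \<Longrightarrow> (R z)\<^sup>2 = P z"
  using R_branch by (auto simp: sqrt_branch_def intro: analytic_imp_holomorphic)

lemma q_cont: "continuous_on {z. 1 \<le> cmod z} q" and q_sq: "1 \<le> cmod z \<Longrightarrow> (q z)\<^sup>2 = P z / z"
  using q_branch
  by (auto simp: sqrt_branch_def intro: analytic_imp_holomorphic holomorphic_on_imp_continuous_on)

lemma sq_sq: "1 \<le> cmod z \<Longrightarrow> z \<notin> K \<Longrightarrow> (sq z)\<^sup>2 = z"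
  using sq_branch by (auto simp: sqrt_branch_def cuts_def)

lemma a_in_disc: "j \<in> {1..2 * g + 1} \<Longrightarrow> cmod (a j) < 1"
  using strict_mono_onD[OF a_mono, of j "2 * g + 1"] a_less_1 by (cases "j = 2 * g + 1") auto

lemma a_distinct: "i \<in> {1..2 * g + 1} \<Longrightarrow> j \<in> {1..2 * g + 1} \<Longrightarrow> i \<noteq> j \<Longrightarrow> a i \<noteq> a j"
  using strict_mono_onD[OF a_mono, of i j] strict_mono_onD[OF a_mono, of j i]
  by (metis less_irrefl linorder_neqE_nat)

lemma P_eq_0_iff: "P z = 0 \<longleftrightarrow> (\<exists>j\<in>{1..2 * g + 1}. z = a j)"
  unfolding Ppoly_def by (subst prod_zero_iff) auto

lemma Q_eq_0_iff: "Q z = 0 \<longleftrightarrow> (\<exists>j\<in>{1..g}. z = a j)"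
  by (auto simp: Qpoly_def)

lemma P_holo: "P holomorphic_on X"
  unfolding Ppoly_def by (intro holomorphic_intros)

lemma Q_holo: "Q holomorphic_on X"
  unfolding Qpoly_def by (intro holomorphic_intros)

lemma R_nonzero: "z \<notin> K \<Longrightarrow> R z \<noteq> 0"
  using R_sq[of z] P_eq_0_iff[of z] branch_point_in_cuts[OF cut_sys] by fastforce

lemma q_nonzero: "1 \<le> cmod z \<Longrightarrow> q z \<noteq> 0"
  using q_sq[of z] P_eq_0_iff[of z] a_in_disc by fastforce

lemma P_simple_zero:
  assumes j: "j \<in> {1..2 * g + 1}"
  obtains d where "(P has_field_derivative d) (at (a j))" "d \<noteq> 0"
proof -
  let ?u = "\<lambda>z. \<Prod>k\<in>{1..2 * g + 1} - {j}. z - a k"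
  have P: "P = (\<lambda>z. (z - a j) * ?u z)"
    unfolding Ppoly_def by (intro ext prod.remove j) simp
  have "?u holomorphic_on UNIV" by (intro holomorphic_intros)
  then obtain d where d: "(?u has_field_derivative d) (at (a j))"
    by (metis UNIV_I field_differentiable_def holomorphic_on_imp_differentiable_at open_UNIV)
  have "(P has_field_derivative ?u (a j)) (at (a j))"
  proof -
    have "((\<lambda>z. z - a j) has_field_derivative 1) (at (a j))"
      by (auto intro!: derivative_eq_intros)
    from DERIV_mult[OF this d] show ?thesis unfolding P by simp
  qed
  moreover have "?u (a j) \<noteq> 0" using a_distinct j by auto
  ultimately show ?thesis using that by blast
qed

lemma R_flips:
  assumes j: "j \<in> {1..g + 1}" and s: "s \<in> {0<..<1}"
  obtains w where "w \<noteq> 0" "(R \<longlongrightarrow> w) (left_side (\<gamma> j) s)" "(R \<longlongrightarrow> - w) (right_side (\<gamma> j) s)"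
proof -
  interpret regular_slit K "\<gamma> j" by (rule cut_system_slit[OF cut_sys j])
  define k where "k = 2 * j - 1"
  have k: "k \<in> {1..2 * g + 1}" using j by (auto simp: k_def)
  have tip: "\<gamma> j 0 = a k"
    using cut_sys j unfolding cut_system_def k_def pathstart_def
    by (cases "j = g + 1") auto
  obtain d where d: "(P has_field_derivative d) (at (a k))" "d \<noteq> 0"
    using P_simple_zero[OF k] by blast
  have off: "P (\<gamma> j u) \<noteq> 0" if "u \<in> {0<..<1}" for u
    using branch_point_off_open_cut[OF cut_sys _ j that] by (auto simp: P_eq_0_iff)
  have tip0: "P (\<gamma> j 0) = 0" unfolding tip P_eq_0_iff using k by blast
  have "flips_across R s"
    by (rule sqrt_flips_across_slit[OF R_holo R_sq P_holo off tip0 d(1)[folded tip] d(2) s])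
  then show ?thesis using that by (auto simp: flips_across_def)
qed

lemma Tm_props: "mat_analytic_on Tm {z. 1 < cmod z}" "continuous_on {z. 1 \<le> cmod z} Tm"
    "1 \<le> cmod z \<Longrightarrow> invertible (Tm z)" "(Tm \<longlongrightarrow> mat 1) at_infinity"
  and Tp_props: "mat_analytic_on Tp {z. cmod z < 1}" "continuous_on {z. cmod z \<le> 1} Tp"
    "cmod z \<le> 1 \<Longrightarrow> invertible (Tp z)"
  and fac: "cmod z = 1 \<Longrightarrow> mexp (xi t z) ** Wmat g a q z = Tm z ** Tp z"
  using factorized by (auto simp: factorization_def)

text \<open>The part of \<open>S\<close> that is free of branches. It is a function on the whole plane: on the cuts it is
  continuous, with the exception of \<open>a\<^sub>1, \<dots>, a\<^sub>g\<close>, where \<open>1 / Q\<close> takes the default value of division by zero.\<close>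

definition regular_factor :: "complex \<Rightarrow> cmat2" where
  "regular_factor z = (if cmod z \<le> 1 then mat2 1 0 0 (1 / Q z) ** matrix_inv (Tp z)
     else mat2 1 0 0 (1 / q z) ** (mexp (- xi t z) ** Tm z))"

text \<open>Multiply \<open>exp \<xi> W = T\<^sub>- T\<^sub>+\<close> by \<open>exp(- \<xi>)\<close> on the left and by \<open>T\<^sub>+\<^sup>-\<^sup>1\<close> on the right.\<close>

lemma factors_agree:
  assumes z: "cmod z = 1"
  shows "mat2 1 0 0 (1 / Q z) ** matrix_inv (Tp z) = mat2 1 0 0 (1 / q z) ** (mexp (- xi t z) ** Tm z)"
proof -
  have "z \<noteq> 0" using z by auto
  have Tp: "Tp z ** matrix_inv (Tp z) = mat 1"
    using cmat2_matrix_inv(1)[OF Tp_props(3)] z by simp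
  have "mexp (- xi t z) ** Tm z = mexp (- xi t z) ** (Tm z ** Tp z) ** matrix_inv (Tp z)"
    by (simp add: matrix_mul_assoc[symmetric] Tp)
  also have "\<dots> = (mexp (- xi t z) ** mexp (xi t z)) ** Wmat g a q z ** matrix_inv (Tp z)"
    by (simp add: fac[OF z, symmetric] matrix_mul_assoc)
  also have "\<dots> = Wmat g a q z ** matrix_inv (Tp z)"
    by (simp add: mexp_xi_inverse[OF \<open>z \<noteq> 0\<close>])
  finally have "mat2 1 0 0 (1 / q z) ** (mexp (- xi t z) ** Tm z) =
      (mat2 1 0 0 (1 / q z) ** Wmat g a q z) ** matrix_inv (Tp z)"
    by (simp add: matrix_mul_assoc)
  moreover have "mat2 1 0 0 (1 / q z) ** Wmat g a q z = mat2 1 0 0 (1 / Q z)"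
    using q_nonzero[of z] z by (simp add: Wmat_def mat2_mult)
  ultimately show ?thesis by simp
qed

lemma S_in_eq: "S_in g a R Tp z = mat2 1 (R z) 1 (- R z) ** (mat2 1 0 0 (1 / Q z) ** matrix_inv (Tp z))"
  by (simp add: S_in_def AWmat_def matrix_mul_assoc mat2_mult)

lemma S_out_eq:
  assumes "1 \<le> cmod z" "z \<notin> K"
  shows "S_out t sq Tm z = mat2 1 (R z) 1 (- R z) ** (mat2 1 0 0 (1 / q z) ** (mexp (- xi t z) ** Tm z))"
  using q_nonzero[OF assms(1)] R_outside[OF assms]
  by (simp add: S_out_def Amat_def matrix_mul_assoc mat2_mult)

lemma S_eq:
  assumes "z \<notin> K"
  shows "S z = mat2 1 (R z) 1 (- R z) ** regular_factor z"
  using S_out_eq[of z] S_in_eq[of z] factors_agree[of z] assms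
  by (cases "cmod z" "1 :: real" rule: linorder_cases) (simp_all add: Sfun_def regular_factor_def)

lemma invertible_exp_xi: "z \<noteq> 0 \<Longrightarrow> invertible (mexp (- xi t z))"
  using mexp_xi_inverse[of z t] by (metis invertible_def matrix_left_right_inverse)

lemma regular_factor_invertible:
  assumes "z \<notin> a ` {1..g}"
  shows "invertible (regular_factor z)"
proof (cases "cmod z \<le> 1")
  case True
  then have "invertible (matrix_inv (Tp z))"
    using cmat2_matrix_inv[OF Tp_props(3)] by (metis invertible_def)
  moreover have "Q z \<noteq> 0" using assms by (auto simp: Q_eq_0_iff)
  ultimately show ?thesis
    using True by (simp add: regular_factor_def invertible_mult invertible_mat2_iff)
next
  case False
  then show ?thesis
    using q_nonzero[of z] invertible_exp_xi[of z] Tm_props(3)[of z]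
    by (cases "z = 0") (auto simp: regular_factor_def invertible_mat2_iff intro!: invertible_mult)
qed

lemma regular_factor_continuous: "continuous_on (- a ` {1..g}) regular_factor"
  unfolding regular_factor_def
proof (rule continuous_on_cases_le)
  let ?X = "- a ` {1..g}"
  have "continuous_on {z \<in> ?X. cmod z \<le> 1} (\<lambda>z. matrix_inv (Tp z))"
    using Tp_props by (intro continuous_on_matrix_inv_cmat2 continuous_on_subset[OF Tp_props(2)]) auto
  moreover have "continuous_on {z \<in> ?X. cmod z \<le> 1} (\<lambda>z. 1 / Q z)"
    by (intro continuous_intros holomorphic_on_imp_continuous_on Q_holo) (auto simp: Q_eq_0_iff)
  ultimately show "continuous_on {z \<in> ?X. cmod z \<le> 1} (\<lambda>z. mat2 1 0 0 (1 / Q z) ** matrix_inv (Tp z))"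
    by (intro continuous_on_cmat2_mult continuous_on_mat2 continuous_on_const)
  have "continuous_on {z. 1 \<le> cmod z} (\<lambda>z. 1 / q z)"
    using q_nonzero by (intro continuous_intros q_cont) auto
  moreover have "continuous_on {z. 1 \<le> cmod z} (\<lambda>z. mexp (- xi t z))"
    by (intro continuous_at_imp_continuous_on ballI isCont_mexp_minus_xi) auto
  ultimately have "continuous_on {z. 1 \<le> cmod z} (\<lambda>z. mat2 1 0 0 (1 / q z) ** (mexp (- xi t z) ** Tm z))"
    by (intro continuous_on_cmat2_mult continuous_on_mat2 continuous_on_const Tm_props(2))
  then show "continuous_on {z \<in> ?X. 1 \<le> cmod z} (\<lambda>z. mat2 1 0 0 (1 / q z) ** (mexp (- xi t z) ** Tm z))"
    by (rule continuous_on_subset) auto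
  show "continuous_on ?X cmod" by (intro continuous_intros)
qed (simp add: factors_agree)

lemma regular_factor_tendsto:
  assumes "z \<notin> a ` {1..g}"
  shows "(regular_factor \<longlongrightarrow> regular_factor z) (nhds z)"
proof -
  have "open (- a ` {1..g})" by (simp add: open_Compl finite_imp_closed)
  then have "isCont regular_factor z"
    using regular_factor_continuous assms by (simp add: continuous_on_eq_continuous_at)
  then show ?thesis by (simp add: continuous_at tendsto_at_iff_tendsto_nhds)
qed

text \<open>Any limit of \<open>S\<close>, two-sided or one-sided, is obtained from the corresponding limit of the scalar \<open>R\<close>.\<close>

lemma S_tendsto:
  assumes "F \<le> nhds z" "\<forall>\<^sub>F z in F. z \<notin> K" "z \<notin> a ` {1..g}" "(R \<longlongrightarrow> w) F"
  shows "(S \<longlongrightarrow> mat2 1 w 1 (- w) ** regular_factor z) F"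
proof (rule Lim_transform_eventually)
  show "((\<lambda>z. mat2 1 (R z) 1 (- R z) ** regular_factor z) \<longlongrightarrow> mat2 1 w 1 (- w) ** regular_factor z) F"
    using tendsto_mono[OF assms(1) regular_factor_tendsto[OF assms(3)]] assms(4)
    by (intro tendsto_intros)
  show "\<forall>\<^sub>F z in F. mat2 1 (R z) 1 (- R z) ** regular_factor z = S z"
    using assms(2) by eventually_elim (simp add: S_eq)
qed

lemma branch_points_in_K: "a ` {1..g} \<subseteq> K"
  using branch_point_in_cuts[OF cut_sys] by auto

lemma S_continuous_off_cuts:
  assumes z: "z \<notin> K"
  shows "(S \<longlongrightarrow> S z) (nhds z)"
proof -
  have "open (- K)" using closed_cuts[OF cut_sys] by (simp add: open_Compl)
  moreover have "continuous_on (- K) R" using R_holo by (rule holomorphic_on_imp_continuous_on)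
  ultimately have "isCont R z" "\<forall>\<^sub>F w in nhds z. w \<in> - K"
    using z eventually_nhds_in_open[of "- K" z] by (simp_all add: continuous_on_eq_continuous_at)
  then show ?thesis
    unfolding S_eq[OF z] using z branch_points_in_K
    by (intro S_tendsto) (auto simp: continuous_at tendsto_at_iff_tendsto_nhds)
qed

lemma no_jump_on_circle:
  assumes z: "cmod z = 1" "z \<notin> K"
  shows "S_out t sq Tm z = S_in g a R Tp z"
    and "\<exists>M. (S \<longlongrightarrow> M) (at z within {z. cmod z < 1}) \<and> (S \<longlongrightarrow> M) (at z within {z. cmod z > 1}) \<and> M = S z"
proof -
  show "S_out t sq Tm z = S_in g a R Tp z"
    using z by (simp add: S_in_eq S_out_eq factors_agree)
  have "(S \<longlongrightarrow> S z) (at z within X)" for X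
    by (rule tendsto_mono[OF _ S_continuous_off_cuts[OF z(2)]]) (simp add: at_within_def)
  then show "\<exists>M. (S \<longlongrightarrow> M) (at z within {z. cmod z < 1}) \<and> (S \<longlongrightarrow> M) (at z within {z. cmod z > 1}) \<and> M = S z"
    by blast
qed

lemma S_invertible:
  assumes z: "z \<notin> K"
  shows "invertible (S z)"
  unfolding S_eq[OF z] using R_nonzero[OF z] branch_points_in_K z
  by (intro invertible_mult regular_factor_invertible) (auto simp: invertible_mat2_iff)

lemma S_one_sided_limits:
  assumes j: "j \<in> {1..g + 1}" and s: "s \<in> {0<..<1}"
  obtains w N where "w \<noteq> 0" "invertible N"
    "has_left_limit S (mat2 1 w 1 (- w) ** N) (\<gamma> j) s"
    "has_right_limit S (mat2 1 (- w) 1 w ** N) (\<gamma> j) s"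
proof -
  interpret regular_slit K "\<gamma> j" by (rule cut_system_slit[OF cut_sys j])
  obtain w where w: "w \<noteq> 0" "(R \<longlongrightarrow> w) (left_side (\<gamma> j) s)" "(R \<longlongrightarrow> - w) (right_side (\<gamma> j) s)"
    by (rule R_flips[OF j s])
  have off: "\<gamma> j s \<notin> a ` {1..g}"
  proof
    assume "\<gamma> j s \<in> a ` {1..g}"
    then obtain k where "k \<in> {1..2 * g + 1}" "\<gamma> j s = a k" by force
    then show False using branch_point_off_open_cut[OF cut_sys _ j s] by blast
  qed
  note side = sides_le_nhds[OF s]
  show ?thesis
    using that[OF w(1) regular_factor_invertible[OF off]]
      S_tendsto[OF side(1,3) off w(2)] S_tendsto[OF side(2,4) off w(3)]
    by (simp add: has_left_limit_iff has_right_limit_iff)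
qed

text \<open>By \<open>S_one_sided_limits\<close> the two limits differ by the sign of \<open>w\<close>, that is, by an exchange of rows.\<close>

lemma S_jump:
  assumes "j \<in> {1..g + 1}" and "s \<in> {0<..<1}"
  shows "\<exists>SL SR. has_left_limit S SL (\<gamma> j) s \<and> has_right_limit S SR (\<gamma> j) s \<and> SL = mat2 0 1 1 0 ** SR"
proof -
  obtain w N where wN: "has_left_limit S (mat2 1 w 1 (- w) ** N) (\<gamma> j) s"
    "has_right_limit S (mat2 1 (- w) 1 w ** N) (\<gamma> j) s"
    using S_one_sided_limits[OF assms] by metis
  have "mat2 1 w 1 (- w) ** N = mat2 0 1 1 0 ** (mat2 1 (- w) 1 w ** N)"
    by (simp add: matrix_mul_assoc mat2_mult)
  then show ?thesis using wN by blast
qed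

lemma one_sided_limit_invertible:
  assumes "j \<in> {1..g + 1}" and "s \<in> {0<..<1}"
    and M: "has_left_limit S M (\<gamma> j) s \<or> has_right_limit S M (\<gamma> j) s"
  shows "invertible M"
proof -
  obtain w N where w: "w \<noteq> 0" and N: "invertible N"
    and l: "has_left_limit S (mat2 1 w 1 (- w) ** N) (\<gamma> j) s"
    and r: "has_right_limit S (mat2 1 (- w) 1 w ** N) (\<gamma> j) s"
    by (rule S_one_sided_limits[OF assms(1,2)])
  have "M = mat2 1 w 1 (- w) ** N \<or> M = mat2 1 (- w) 1 w ** N"
    using M l r tendsto_unique[OF side_ne_bot(1)] tendsto_unique[OF side_ne_bot(2)]
    unfolding has_left_limit_iff has_right_limit_iff by blast
  moreover have "invertible (mat2 1 w 1 (- w))" "invertible (mat2 1 (- w) 1 w)"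
    using w by (auto simp: invertible_mat2_iff)
  ultimately show ?thesis using N by (auto intro: invertible_mult)
qed

text \<open>With \<open>P = (z - a\<^sub>j) p\<^sup>2\<close> the function \<open>\<rho> = R / p\<close> is a root of \<open>z - a\<^sub>j\<close>. If \<open>j > g\<close>, then \<open>R / Q = \<rho> \<cdot> p / Q\<close>.
  If \<open>j \<le> g\<close>, then \<open>Q = \<rho>\<^sup>2 v\<close> with \<open>v\<close> nonzero near \<open>a\<^sub>j\<close>, and \<open>R / Q = \<rho>\<^sup>-\<^sup>1 \<cdot> p / v\<close>. Shrinking the disc so
  that it lies inside the unit disc makes the inner expression of \<open>S\<close> valid on it.\<close>

lemma R_over_Q_at_branch_point:
  assumes j: "j \<in> {1..2 * g + 1}"
  obtains \<epsilon> \<rho> h where "\<epsilon> > 0" "ball (a j) \<epsilon> \<subseteq> ball 0 1"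
    "sqrt_branch (ball (a j) \<epsilon> - K) (\<lambda>z. z - a j) \<rho>"
    "h analytic_on ball (a j) \<epsilon>" "h (a j) \<noteq> 0"
    "\<And>z. z \<in> ball (a j) \<epsilon> - K \<Longrightarrow> R z / Q z = \<rho> z powi (if j \<le> g then -1 else 1) * h z"
proof -
  let ?u = "\<lambda>z. \<Prod>k\<in>{1..2 * g + 1} - {j}. z - a k"
  let ?v = "\<lambda>z. \<Prod>k\<in>{1..g} - {j}. z - a k"
  let ?X = "ball 0 1 - a ` ({1..2 * g + 1} - {j})"
  have P: "P z = (z - a j) * ?u z" for z
    unfolding Ppoly_def by (intro prod.remove j) simp
  have "open ?X" by (intro open_Diff finite_imp_closed) auto
  moreover have "a j \<notin> a ` ({1..2 * g + 1} - {j})" using a_distinct[OF j] by blast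
  then have "a j \<in> ?X" using a_in_disc[OF j] by simp
  ultimately obtain \<epsilon> where \<epsilon>: "\<epsilon> > 0" "ball (a j) \<epsilon> \<subseteq> ?X" by (meson openE)
  let ?B = "ball (a j) \<epsilon>"
  have u_nz: "?u z \<noteq> 0" and v_nz: "?v z \<noteq> 0" if "z \<in> ?B" for z
    using \<epsilon>(2) that by auto
  obtain p where p: "p holomorphic_on ?B" "\<And>z. z \<in> ?B \<Longrightarrow> ?u z = (p z)\<^sup>2"
  proof (rule contractible_imp_holomorphic_sqrt)
    show "?u holomorphic_on ?B" by (intro holomorphic_intros)
    show "contractible ?B" by (simp add: convex_imp_contractible)
  qed (use u_nz in auto)
  have p_nz: "p z \<noteq> 0" if "z \<in> ?B" for z using p(2)[OF that] u_nz[OF that] by auto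
  define \<rho> where "\<rho> z = R z / p z" for z
  define h where "h z = p z / ?v z" for z
  have "open (?B - K)" using closed_cuts[OF cut_sys] by (intro open_Diff) auto
  moreover have "\<rho> holomorphic_on ?B - K"
    unfolding \<rho>_def using p_nz
    by (intro holomorphic_intros holomorphic_on_subset[OF p(1)] holomorphic_on_subset[OF R_holo]) auto
  moreover have \<rho>2: "(\<rho> z)\<^sup>2 = z - a j" if "z \<in> ?B - K" for z
    using that R_sq[of z] P[of z] p(2)[of z] u_nz[of z] by (simp add: \<rho>_def power_divide)
  ultimately have "sqrt_branch (?B - K) (\<lambda>z. z - a j) \<rho>"
    by (simp add: sqrt_branch_def analytic_on_open)
  moreover have "h holomorphic_on ?B"
    unfolding h_def using v_nz by (intro holomorphic_intros p(1)) auto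
  then have "h analytic_on ?B" by (simp add: analytic_on_open)
  moreover have "h (a j) \<noteq> 0"
    using p_nz[of "a j"] v_nz[of "a j"] \<epsilon>(1) by (simp add: h_def)
  moreover have "R z / Q z = \<rho> z powi (if j \<le> g then -1 else 1) * h z" if z: "z \<in> ?B - K" for z
  proof (cases "j \<le> g")
    case True
    then have Q: "Q z = (z - a j) * ?v z" using j by (auto simp: Qpoly_def prod.remove)
    have R: "R z = \<rho> z * p z" using p_nz[of z] z by (simp add: \<rho>_def)
    have "\<rho> z \<noteq> 0" using R_nonzero[of z] R z by auto
    then have "R z / Q z = inverse (\<rho> z) * h z"
      unfolding R Q \<rho>2[OF z, symmetric] h_def by (simp add: power2_eq_square field_simps)
    then show ?thesis using True by (simp add: power_int_minus)
  next
    case False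
    then have "{1..g} - {j} = {1..g}" by auto
    then show ?thesis using False p_nz[of z] z by (simp add: \<rho>_def h_def Qpoly_def)
  qed
  moreover have "?B \<subseteq> ball 0 1" using \<epsilon>(2) by blast
  ultimately show ?thesis using that \<epsilon>(1) by blast
qed

lemma S_at_branch_point:
  assumes j: "j \<in> {1..2 * g + 1}"
  shows "\<exists>\<epsilon>>0. \<exists>\<rho> Sj.
        sqrt_branch (ball (a j) \<epsilon> - K) (\<lambda>z. z - a j) \<rho> \<and>
        mat_analytic_on Sj (ball (a j) \<epsilon>) \<and> invertible (Sj (a j)) \<and>
        (\<forall>z\<in>ball (a j) \<epsilon> - K.
           S z = mat2 1 1 1 (-1) ** mat2 1 0 0 (\<rho> z powi (if j \<le> g then -1 else 1)) ** Sj z)"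
proof -
  obtain \<epsilon> \<rho> h where \<epsilon>: "\<epsilon> > 0" "ball (a j) \<epsilon> \<subseteq> ball 0 1"
    and \<rho>: "sqrt_branch (ball (a j) \<epsilon> - K) (\<lambda>z. z - a j) \<rho>"
    and h: "h analytic_on ball (a j) \<epsilon>" "h (a j) \<noteq> 0"
    and RQ: "\<And>z. z \<in> ball (a j) \<epsilon> - K \<Longrightarrow> R z / Q z = \<rho> z powi (if j \<le> g then -1 else 1) * h z"
    by (rule R_over_Q_at_branch_point[OF j]) (rule that)
  let ?B = "ball (a j) \<epsilon>"
  define Sj where "Sj z = mat2 1 0 0 (h z) ** matrix_inv (Tp z)" for z
  have disc: "cmod z < 1" if "z \<in> ?B" for z using \<epsilon>(2) that by auto
  have "mat_analytic_on Tp ?B"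
    using Tp_props(1) disc unfolding mat_analytic_on_def by (meson analytic_on_subset mem_Collect_eq subsetI)
  then have "mat_analytic_on (\<lambda>z. matrix_inv (Tp z)) ?B"
    using Tp_props(3) disc by (intro mat_analytic_on_matrix_inv) (auto intro: less_imp_le)
  then have "mat_analytic_on Sj ?B"
    unfolding Sj_def using h(1) by (intro mat_analytic_on_mult mat_analytic_on_mat2) auto
  moreover have "invertible (Tp (a j))" using Tp_props(3) a_in_disc[OF j] by simp
  then have "invertible (matrix_inv (Tp (a j)))"
    using cmat2_matrix_inv by (metis invertible_def)
  then have "invertible (Sj (a j))"
    unfolding Sj_def using h(2) by (intro invertible_mult) (auto simp: invertible_mat2_iff)
  moreover have "S z = mat2 1 1 1 (-1) ** mat2 1 0 0 (\<rho> z powi (if j \<le> g then -1 else 1)) ** Sj z"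
    if z: "z \<in> ?B - K" for z
  proof -
    have "S z = mat2 1 1 1 (-1) ** mat2 1 0 0 (R z / Q z) ** matrix_inv (Tp z)"
      using disc[of z] z by (simp add: Sfun_def S_in_def AWmat_def mat2_mult)
    also have "mat2 1 0 0 (R z / Q z) = mat2 1 0 0 (\<rho> z powi (if j \<le> g then -1 else 1)) ** mat2 1 0 0 (h z)"
      unfolding RQ[OF z] by (simp add: mat2_mult)
    finally show ?thesis by (simp add: Sj_def matrix_mul_assoc)
  qed
  ultimately show ?thesis using \<epsilon>(1) \<rho> by blast
qed

lemma S_at_infinity:
  "\<exists>E. (\<forall>i k. (\<lambda>z. E z $ i $ k) \<in> O[at_infinity](\<lambda>z. 1 / z)) \<and>
     (\<forall>\<^sub>F z in at_infinity. z \<notin> K \<longrightarrow> S z = S_asymp t sq z ** (mat 1 + E z))"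
proof (intro exI conjI allI)
  fix i k
  have "(\<lambda>z. Tm z $ i $ k) analytic_on {z. 1 < cmod z}"
    using Tm_props(1) by (simp add: mat_analytic_on_def)
  moreover have "((\<lambda>z. Tm z $ i $ k) \<longlongrightarrow> (mat 1 :: cmat2) $ i $ k) at_infinity"
    using Tm_props(4) by (simp add: tendsto_cmat2_iff)
  ultimately show "(\<lambda>z. (Tm z - mat 1) $ i $ k) \<in> O[at_infinity](\<lambda>z. 1 / z)"
    using limit_at_infinity_rate by simp
next
  have "\<forall>\<^sub>F z::complex in at_infinity. 1 \<le> cmod z"
    by (auto simp: eventually_at_infinity)
  then show "\<forall>\<^sub>F z in at_infinity. z \<notin> K \<longrightarrow> S z = S_asymp t sq z ** (mat 1 + (Tm z - mat 1))"
  proof eventually_elim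
    case (elim z)
    show ?case
    proof
      assume z: "z \<notin> K"
      have "z \<noteq> 0" using elim by auto
      have "Amat sq z ** mexp (- xi t z) = S_asymp t sq z"
        using Amat_mexp_xi(2)[OF sq_sq[OF elim z] \<open>z \<noteq> 0\<close>, of t]
        by (simp add: Amat_def S_asymp_def theta_def mat2_mult mult.commute)
      then show "S z = S_asymp t sq z ** (mat 1 + (Tm z - mat 1))"
        using elim by (simp add: Sfun_def S_out_def)
    qed
  qed
qed

end

theorem proposition6p13:
  fixes g :: nat and a t :: "nat \<Rightarrow> complex" and \<gamma> :: "nat \<Rightarrow> real \<Rightarrow> complex"
    and q sq R :: "complex \<Rightarrow> complex" and Tm Tp :: "complex \<Rightarrow> complex^2^2"
  defines "S \<equiv> Sfun g a t sq R Tm Tp"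
  assumes g: "g \<ge> 1"
    and a_mono: "strict_mono_on {1..2 * g + 1} (\<lambda>j. cmod (a j))"
    and a_less_1: "cmod (a (2 * g + 1)) < 1"
    and t_finite: "finite (times_support t)"
    and cut_sys: "cut_system g a \<gamma>"
    and R_branch: "sqrt_branch (- cuts g \<gamma>) (Ppoly g a) R"
    and q_branch: "sqrt_branch {z. 1 \<le> cmod z} (\<lambda>z. Ppoly g a z / z) q"
    and q_infinity: "(\<lambda>z. q z / z ^ g - 1) \<in> O[at_infinity](\<lambda>z. 1 / z)"
    and sq_branch: "sqrt_branch ({z. 1 \<le> cmod z} - cut g \<gamma> (g + 1)) (\<lambda>z. z) sq"
    and R_outside: "\<And>z. 1 \<le> cmod z \<Longrightarrow> z \<notin> cuts g \<gamma> \<Longrightarrow> R z = sq z * q z"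
    and factorized: "factorization (\<lambda>z. mexp (xi t z) ** Wmat g a q z) Tm Tp"
  shows
    \<comment> \<open>(1)\<close>
    "(\<forall>z. cmod z = 1 \<and> z \<notin> cuts g \<gamma> \<longrightarrow>
        S_out t sq Tm z = S_in g a R Tp z \<and>
        (\<exists>M. (S \<longlongrightarrow> M) (at z within {z. cmod z < 1}) \<and> (S \<longlongrightarrow> M) (at z within {z. cmod z > 1}) \<and>
             M = S z))
    \<comment> \<open>(2)\<close>
    \<and> (\<forall>j\<in>{1..g + 1}. \<forall>s\<in>{0<..<1}. \<exists>SL SR.
        has_left_limit S SL (\<gamma> j) s \<and> has_right_limit S SR (\<gamma> j) s \<and> SL = mat2 0 1 1 0 ** SR)
    \<comment> \<open>(3); at points of the open cuts, invertibility refers to the limiting values from both sides\<close>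
    \<and> (\<forall>z. z \<notin> cuts g \<gamma> \<longrightarrow> invertible (S z))
    \<and> (\<forall>j\<in>{1..g + 1}. \<forall>s\<in>{0<..<1}. \<forall>M.
        has_left_limit S M (\<gamma> j) s \<or> has_right_limit S M (\<gamma> j) s \<longrightarrow> invertible M)
    \<and> (\<forall>j\<in>{1..2 * g + 1}. \<exists>\<epsilon>>0. \<exists>\<rho> Sj.
        sqrt_branch (ball (a j) \<epsilon> - cuts g \<gamma>) (\<lambda>z. z - a j) \<rho> \<and>
        mat_analytic_on Sj (ball (a j) \<epsilon>) \<and> invertible (Sj (a j)) \<and>
        (\<forall>z\<in>ball (a j) \<epsilon> - cuts g \<gamma>.
           S z = mat2 1 1 1 (-1) ** mat2 1 0 0 (\<rho> z powi (if j \<le> g then -1 else 1)) ** Sj z))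
    \<comment> \<open>(4)\<close>
    \<and> (\<exists>E. (\<forall>i k. (\<lambda>z. E z $ i $ k) \<in> O[at_infinity](\<lambda>z. 1 / z)) \<and>
        (\<forall>\<^sub>F z in at_infinity. z \<notin> cuts g \<gamma> \<longrightarrow> S z = S_asymp t sq z ** (mat 1 + E z)))"
proof -
  interpret spectral_problem g a t \<gamma> q sq R Tm Tp
    by unfold_locales (fact a_mono a_less_1 cut_sys R_branch q_branch sq_branch R_outside factorized)+
  show ?thesis
    unfolding S_def
    using no_jump_on_circle S_jump S_invertible one_sided_limit_invertible S_at_branch_point S_at_infinity
    by (intro conjI ballI allI impI) blast+
qed

end
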